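(* Let $\nu\in\mathcal P_s$ with $\nu(\{0\})=0$, and let $t\ge a>0$ with $\nu(\{a\})=\nu(\{t\})=0$ and $G(t)\ne2G(a)$. Write $D=2G(a)-G(t)$. Then $II(1,a,t)=\frac12\big(H(a)+H(t)+G(a)+G(t)\big)$ and for all $n\ge2$ $$\begin{aligned}II(n,a,t)={}&G(a)^n\Big[\frac{(n+1)H(a)+G(a)}{D}-\frac{2G(a)H(a)}{D^2}+\frac{H(t)}{D}\Big(nC_2+C_3-\frac{2C_2G(a)}{D}\Big)\Big]\\&+\Big(\frac{G(t)}2\Big)^{n-1}\Big[II(1,a,t)-\frac{G(a)(H(a)+G(a))}{D}+\frac{G(a)G(t)H(a)}{D^2}+\frac{(n-1)C_1H(t)}{G(t)}-\frac{G(a)H(t)}{D}\Big(C_3-\frac{C_2G(t)}{D}\Big)\Big],\end{aligned}$$ where $I(1,a,t)=\tfrac12G(t)+\tfrac12H(a)\Psi(\tfrac at)+\tfrac12G(a)$ and $C_1=I(1,a,t)-\frac{G(a)}{D}\big[G(a)+H(a)\Psi(\frac at)(1-\frac{G(t)}{D})\big]$, $C_2=\frac{H(a)\Psi(\frac at)}{D}$, $C_3=\frac{H(a)\Psi(\frac at)+G(a)}{D}-\frac{2H(a)G(a)\Psi(\frac at)}{D^2}$.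
   Context: Fix $\alpha>0$. $\mathcal P_s$ is the set of symmetric Borel probability measures on $\mathbb R$. For $x\in\mathbb R$, $\widetilde\delta_x=\frac12(\delta_x+\delta_{-x})$. For a probability measure $\lambda=\mathcal L(X)$ and $c>0$, $T_c\lambda=\mathcal L(cX)$, and $T_0\lambda=\delta_0$. $\widetilde\pi_{2\alpha}$ is the symmetric Pareto probability measure with density $\alpha|y|^{-2\alpha-1}\mathbf 1_{\{|y|\ge1\}}$. The Kendall convolution $\vartriangle_\alpha$ on $\mathcal P_s$ is defined by $\widetilde\delta_x\vartriangle_\alpha\widetilde\delta_y=T_M\big(\varrho^\alpha\widetilde\pi_{2\alpha}+(1-\varrho^\alpha)\widetilde\delta_1\big)$ where $M=\max(|x|,|y|)$, $m=\min(|x|,|y|)$, $\varrho=m/M$ (and $\varrho=0$ if $M=0$), extended by $(\nu_1\vartriangle_\alpha\nu_2)(A)=\int\int(\widetilde\delta_x\vartriangle_\alpha\widetilde\delta_y)(A)\,\nu_1(dx)\nu_2(dy)$. For $x\in\mathbb R$ and $\mu\in\mathcal P_s$ we write $\delta_x\vartriangle_\alpha\mu:=\widetilde\delta_x\vartriangle_\alpha\mu$. $\Psi(t)=(1-|t|^\alpha)_+$. For the measure $\nu$: $F(t)=\nu((-\infty,t])$, $G(t)=\int_{\mathbb R}\Psi(x/t)\,\nu(dx)$ for $t\neq0$, and for $t>0$, $H(t)=2F(t)-1-G(t)=t^{-\alpha}\int_{[-t,t]}|x|^\alpha\nu(dx)$. The Kendall random walk with step distribution $\nu$ is the Markov chain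 $(X_n)_{n\ge0}$ with $X_0=0$ and transition kernel $\mathbb P(X_{k+1}\in A\mid X_k=x)=(\delta_x\vartriangle_\alpha\nu)(A)$. For $a,t>0$ and $n\ge1$, $II(n,a,t)=\int_{(-\infty,a]}\cdots\int_{(-\infty,a]}\mathbf 1_{\{|x_n|<t\}}\,(\delta_{x_{n-1}}\vartriangle_\alpha\nu)(dx_n)\cdots(\delta_{x_1}\vartriangle_\alpha\nu)(dx_2)\,\nu(dx_1)$ ($n$ integrations), i.e. $II(n,a,t)=\mathbb P(X_1\le a,\dots,X_n\le a,\ |X_n|<t)$. *)

theory Defs
  imports "HOL-Probability.Probability"
begin

definition sym_prob :: "real measure \<Rightarrow> bool" where
  "sym_prob \<nu> \<longleftrightarrow> prob_space \<nu> \<and> sets \<nu> = sets borel \<and>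
     (\<forall>A \<in> sets borel. measure \<nu> (uminus ` A) = measure \<nu> A)"

definition sym_pareto :: "real \<Rightarrow> real measure" where
  "sym_pareto \<alpha> = density lborel
     (\<lambda>y. ennreal (if 1 \<le> \<bar>y\<bar> then \<alpha> * \<bar>y\<bar> powr (-2*\<alpha>-1) else 0))"

definition sdelta :: "real \<Rightarrow> real set \<Rightarrow> real" where
  "sdelta x A = (indicator A x + indicator A (-x)) / 2"

text \<open>(sdelta x  Kendall-convolved with  sdelta y)(A) =
  T_M (rho^alpha sym_pareto + (1 - rho^alpha) sdelta 1)(A), and T_0 lambda = delta_0.\<close>
definition kendall_pair :: "real \<Rightarrow> real \<Rightarrow> real \<Rightarrow> real set \<Rightarrow> real" where
  "kendall_pair \<alpha> x y A =
     (let M = max \<bar>x\<bar> \<bar>y\<bar>; m = min \<bar>x\<bar> \<bar>y\<bar>; \<rho> = (if M = 0 then 0 else m / M) in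
      if M = 0 then indicator A 0
      else \<rho> powr \<alpha> * measure (sym_pareto \<alpha>) {z. M * z \<in> A}
           + (1 - \<rho> powr \<alpha>) * sdelta 1 {z. M * z \<in> A})"

definition kendall_step :: "real \<Rightarrow> real measure \<Rightarrow> real \<Rightarrow> real measure" where
  "kendall_step \<alpha> \<nu> x =
     measure_of UNIV (sets borel) (\<lambda>A. \<integral>\<^sup>+ y. ennreal (kendall_pair \<alpha> x y A) \<partial>\<nu>)"

definition Psi :: "real \<Rightarrow> real \<Rightarrow> real" where
  "Psi \<alpha> s = max 0 (1 - \<bar>s\<bar> powr \<alpha>)"

definition Gf :: "real \<Rightarrow> real measure \<Rightarrow> real \<Rightarrow> real" where
  "Gf \<alpha> \<nu> s = (\<integral>x. Psi \<alpha> (x / s) \<partial>\<nu>)"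

definition Hf :: "real \<Rightarrow> real measure \<Rightarrow> real \<Rightarrow> real" where
  "Hf \<alpha> \<nu> s = s powr (-\<alpha>) * (\<integral>x. indicator {-s..s} x * \<bar>x\<bar> powr \<alpha> \<partial>\<nu>)"

text \<open>Backward iteration: II_aux k x is the inner (k-fold) integral of the
  definition of II, given the current position x (including the indicator x <= a).\<close>
fun II_aux :: "real \<Rightarrow> real measure \<Rightarrow> real \<Rightarrow> real \<Rightarrow> nat \<Rightarrow> real \<Rightarrow> real" where
  "II_aux \<alpha> \<nu> a t 0 x = (if x \<le> a \<and> \<bar>x\<bar> < t then 1 else 0)"
| "II_aux \<alpha> \<nu> a t (Suc k) x =
     (if x \<le> a then (\<integral>y. II_aux \<alpha> \<nu> a t k y \<partial>(kendall_step \<alpha> \<nu> x)) else 0)"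

text \<open>II(n,a,t) = P(X_1 <= a, ..., X_n <= a, |X_n| < t), for n >= 1.\<close>
definition II :: "real \<Rightarrow> real measure \<Rightarrow> nat \<Rightarrow> real \<Rightarrow> real \<Rightarrow> real" where
  "II \<alpha> \<nu> n a t = (\<integral>x. II_aux \<alpha> \<nu> a t (n - 1) x \<partial>\<nu>)"

end

theory Submission
  imports Defs
begin

text \<open>
  Write \<open>K\<close> for the transition kernel and \<open>1\<^sub>s\<close>, \<open>\<Psi>\<^sub>s\<close> for the functions \<open>1{|x| < s}\<close>, \<open>\<Psi>(x/s)\<close>. If \<open>s > 0\<close>
  is not an atom of \<open>\<nu>\<close>, then \<open>K 1\<^sub>s = G(s) 1\<^sub>s + H(s) \<Psi>\<^sub>s\<close> and \<open>K \<Psi>\<^sub>s = G(s) \<Psi>\<^sub>s\<close>. Since \<open>K\<close> is symmetric,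
  the constraint \<open>y \<le> a\<close> acts on even functions as half the sum of the identity and the restriction to
  \<open>[-a,a]\<close>, and on \<open>[-a,a]\<close> the function \<open>\<Psi>\<^sub>t\<close> is the convex combination \<open>P 1\<^sub>a + (1 - P) \<Psi>\<^sub>a\<close> with
  \<open>P = \<Psi>(a/t)\<close>. Hence the span of \<open>1\<^sub>t, \<Psi>\<^sub>t, 1\<^sub>a, \<Psi>\<^sub>a\<close> is invariant under one step of the backward
  iteration, which becomes a triangular linear recursion with eigenvalues \<open>G(t)/2\<close> and \<open>G(a)\<close>, each
  of multiplicity two, solved explicitly when \<open>D \<noteq> 0\<close>.
\<close>

section \<open>The symmetric Pareto law\<close>

text \<open>The primitive \<open>- (z powr (-\<beta>) / \<beta>)\<close> vanishes at infinity.
  Integrals over \<open>[1,r)\<close> will appear as differences of two such tails, with exponents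
  \<open>2*\<alpha>\<close> and \<open>\<alpha>\<close>.\<close>

lemma has_bochner_integral_powr_tail:
  fixes \<beta> r :: real
  assumes "0 < \<beta>" "0 < r"
  shows "has_bochner_integral lborel (\<lambda>z. indicator {r..} z * z powr (-\<beta>-1)) (r powr (-\<beta>) / \<beta>)"
proof (rule has_bochner_integral_nn_integral)
  have "(\<integral>\<^sup>+z. ennreal (z powr (-\<beta>-1)) * indicator {r..} z \<partial>lborel)
      = 0 - (- (r powr (-\<beta>) / \<beta>))"
  proof (rule nn_integral_FTC_atLeast)
    fix x assume "r \<le> x"
    then show "((\<lambda>z. - (z powr (-\<beta>) / \<beta>)) has_real_derivative x powr (-\<beta>-1)) (at x)"
      using assms by (auto intro!: derivative_eq_intros)
  next
    have "((\<lambda>z. z powr (-\<beta>)) \<longlongrightarrow> 0) at_top"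
      using assms by (intro tendsto_neg_powr filterlim_ident) auto
    then show "((\<lambda>z. - (z powr (-\<beta>) / \<beta>)) \<longlongrightarrow> 0) at_top"
      using tendsto_mult_right_zero[of _ _ "-1/\<beta>"] by fastforce
  qed auto
  moreover have "(\<integral>\<^sup>+z. ennreal (indicator {r..} z * z powr (-\<beta>-1)) \<partial>lborel)
      = (\<integral>\<^sup>+z. ennreal (z powr (-\<beta>-1)) * indicator {r..} z \<partial>lborel)"
    by (intro nn_integral_cong) (auto split: split_indicator)
  ultimately show "(\<integral>\<^sup>+z. ennreal (indicator {r..} z * z powr (-\<beta>-1)) \<partial>lborel)
      = ennreal (r powr (-\<beta>) / \<beta>)"
    by simp
qed (use assms in auto)

text \<open>The part of the Pareto density on the positive axis, of mass 1/2. It contains no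
  absolute value, so integrals against the symmetric law reduce to power integrals over
  \<open>[1,\<infinity>)\<close>.\<close>

definition pareto_half :: "real \<Rightarrow> real \<Rightarrow> real" where
  "pareto_half \<alpha> z = \<alpha> * (indicator {1..} z * z powr (-2*\<alpha>-1))"

lemma pareto_half_measurable [measurable]: "pareto_half \<alpha> \<in> borel_measurable borel"
  unfolding pareto_half_def by measurable

lemma pareto_half_nonneg: "0 < \<alpha> \<Longrightarrow> 0 \<le> pareto_half \<alpha> z"
  by (simp add: pareto_half_def)

lemma has_bochner_integral_pareto_half:
  assumes "0 < \<alpha>"
  shows "has_bochner_integral lborel (pareto_half \<alpha>) (1/2)"
  using has_bochner_integral_mult_right[OF has_bochner_integral_powr_tail[of "2*\<alpha>" 1], of \<alpha>] assms
  by (simp add: pareto_half_def[abs_def] cong: has_bochner_integral_cong)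

lemma sym_pareto_eq:
  "sym_pareto \<alpha> = density lborel (\<lambda>z. ennreal (pareto_half \<alpha> z + pareto_half \<alpha> (-z)))"
  unfolding sym_pareto_def pareto_half_def
  by (intro arg_cong[where f="density lborel"] ext) (auto simp: indicator_def)

lemma sets_sym_pareto [simp, measurable_cong]: "sets (sym_pareto \<alpha>) = sets borel"
  and space_sym_pareto [simp]: "space (sym_pareto \<alpha>) = UNIV"
  by (simp_all add: sym_pareto_def)

text \<open>Reflection carries the negative half of the density to the positive one. Boundedness of
  \<open>f\<close> makes both halves integrable, so the integral may be split.\<close>

lemma integral_sym_pareto:
  fixes f :: "real \<Rightarrow> real"
  assumes \<alpha>: "0 < \<alpha>" and [measurable]: "f \<in> borel_measurable borel" and B: "\<And>z. \<bar>f z\<bar> \<le> B"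
  shows "(\<integral>z. f z \<partial>sym_pareto \<alpha>) = (\<integral>z. pareto_half \<alpha> z * (f z + f (-z)) \<partial>lborel)"
proof -
  have w: "integrable lborel (pareto_half \<alpha>)"
    using has_bochner_integral_pareto_half[OF \<alpha>] by (simp add: has_bochner_integral_iff)
  have I: "integrable lborel (\<lambda>z. pareto_half \<alpha> z * g z)"
    if [measurable]: "g \<in> borel_measurable borel" and g: "\<And>z. \<bar>g z\<bar> \<le> B" for g :: "real \<Rightarrow> real"
  proof (rule Bochner_Integration.integrable_bound)
    show "integrable lborel (\<lambda>z. B * pareto_half \<alpha> z)" using w by simp
    show "AE z in lborel. norm (pareto_half \<alpha> z * g z) \<le> norm (B * pareto_half \<alpha> z)"
    proof (rule AE_I2)
      fix z
      have "\<bar>g z\<bar> \<le> \<bar>B\<bar>" using g[of z] by simp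
      then show "norm (pareto_half \<alpha> z * g z) \<le> norm (B * pareto_half \<alpha> z)"
        using mult_left_mono[of "\<bar>g z\<bar>" "\<bar>B\<bar>" "pareto_half \<alpha> z"] pareto_half_nonneg[OF \<alpha>, of z]
        by (simp add: abs_mult mult.commute[of B])
    qed
  qed simp
  have I1: "integrable lborel (\<lambda>z. pareto_half \<alpha> z * f z)" by (rule I) (use B in auto)
  have I2: "integrable lborel (\<lambda>z. pareto_half \<alpha> z * f (-z))" by (rule I) (use B in auto)
  have I3: "integrable lborel (\<lambda>z. pareto_half \<alpha> (-z) * f z)"
    using lborel_integrable_real_affine[OF I2, of "-1" 0] by simp
  have eq: "(\<integral>z. pareto_half \<alpha> (-z) * f z \<partial>lborel) = (\<integral>z. pareto_half \<alpha> z * f (-z) \<partial>lborel)"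
    using lborel_integral_real_affine[of "-1" "\<lambda>z. pareto_half \<alpha> z * f (-z)" 0] by simp
  have "(\<integral>z. f z \<partial>sym_pareto \<alpha>)
      = (\<integral>z. (pareto_half \<alpha> z + pareto_half \<alpha> (-z)) * f z \<partial>lborel)"
    unfolding sym_pareto_eq
    by (subst integral_density) (auto simp: pareto_half_nonneg[OF \<alpha>])
  also have "\<dots> = (\<integral>z. pareto_half \<alpha> z * f z \<partial>lborel) + (\<integral>z. pareto_half \<alpha> z * f (-z) \<partial>lborel)"
    using I1 I3 by (simp add: distrib_right eq)
  also have "\<dots> = (\<integral>z. pareto_half \<alpha> z * (f z + f (-z)) \<partial>lborel)"
    using I1 I2 by (simp add: distrib_left)
  finally show ?thesis .
qed

lemma prob_space_sym_pareto:
  assumes \<alpha>: "0 < \<alpha>"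
  shows "prob_space (sym_pareto \<alpha>)"
proof
  have w: "integrable lborel (pareto_half \<alpha>)" "(\<integral>z. pareto_half \<alpha> z \<partial>lborel) = 1/2"
    using has_bochner_integral_pareto_half[OF \<alpha>] by (auto simp: has_bochner_integral_iff)
  have w': "integrable lborel (\<lambda>z. pareto_half \<alpha> (-z))" "(\<integral>z. pareto_half \<alpha> (-z) \<partial>lborel) = 1/2"
    using lborel_integrable_real_affine[OF w(1), of "-1" 0]
      lborel_integral_real_affine[of "-1" "pareto_half \<alpha>" 0] w(2) by auto
  have "emeasure (sym_pareto \<alpha>) UNIV
      = (\<integral>\<^sup>+z. ennreal (pareto_half \<alpha> z + pareto_half \<alpha> (-z)) \<partial>lborel)"
    by (simp add: sym_pareto_eq emeasure_density)
  also have "\<dots> = ennreal (\<integral>z. pareto_half \<alpha> z + pareto_half \<alpha> (-z) \<partial>lborel)"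
    using w w' by (intro nn_integral_eq_integral) (auto simp: pareto_half_nonneg[OF \<alpha>])
  also have "(\<integral>z. pareto_half \<alpha> z + pareto_half \<alpha> (-z) \<partial>lborel) = 1"
    using w w' by (subst Bochner_Integration.integral_add) auto
  finally show "emeasure (sym_pareto \<alpha>) (space (sym_pareto \<alpha>)) = 1" by simp
qed

lemma integral_sym_pareto_uminus:
  fixes f :: "real \<Rightarrow> real"
  assumes "0 < \<alpha>" "f \<in> borel_measurable borel" "\<And>z. \<bar>f z\<bar> \<le> B"
  shows "(\<integral>z. f (-z) \<partial>sym_pareto \<alpha>) = (\<integral>z. f z \<partial>sym_pareto \<alpha>)"
  using assms by (simp add: integral_sym_pareto[where B=B] add.commute)

text \<open>The sign of a symmetric Pareto variable is a fair coin, so it realises the two-point law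
  on \<open>M\<close> and \<open>-M\<close> without a further source of randomness.\<close>

lemma integral_sym_pareto_sgn:
  fixes f :: "real \<Rightarrow> real"
  assumes \<alpha>: "0 < \<alpha>" and [measurable]: "f \<in> borel_measurable borel" and B: "\<And>z. \<bar>f z\<bar> \<le> B"
  shows "(\<integral>z. f (M * sgn z) \<partial>sym_pareto \<alpha>) = (f M + f (-M)) / 2"
proof -
  have "(\<integral>z. f (M * sgn z) \<partial>sym_pareto \<alpha>)
      = (\<integral>z. pareto_half \<alpha> z * (f (M * sgn z) + f (M * sgn (-z))) \<partial>lborel)"
    by (rule integral_sym_pareto[where B=B]) (use \<alpha> B in auto)
  also have "\<dots> = (\<integral>z. pareto_half \<alpha> z * (f M + f (-M)) \<partial>lborel)"
    by (intro Bochner_Integration.integral_cong) (auto simp: pareto_half_def indicator_def)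
  also have "\<dots> = (f M + f (-M)) / 2"
    using has_bochner_integral_pareto_half[OF \<alpha>] by (simp add: has_bochner_integral_iff)
  finally show ?thesis .
qed

lemma Psi_measurable [measurable]: "Psi \<alpha> \<in> borel_measurable borel"
  unfolding Psi_def by measurable

lemma abs_Psi_le_1: "\<bar>Psi \<alpha> s\<bar> \<le> 1"
  by (simp add: Psi_def)

lemma integral_sym_pareto_less:
  assumes \<alpha>: "0 < \<alpha>" and r: "1 \<le> r"
  shows "(\<integral>z. indicator {z. \<bar>z\<bar> < r} z \<partial>sym_pareto \<alpha>) = 1 - r powr (-2*\<alpha>)"
proof -
  have "(\<integral>z. indicator {z. \<bar>z\<bar> < r} z \<partial>sym_pareto \<alpha>)
     = (\<integral>z. pareto_half \<alpha> z * (indicator {z. \<bar>z\<bar> < r} z + indicator {z. \<bar>z\<bar> < r} (-z)) \<partial>lborel)"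
    by (rule integral_sym_pareto[where B=1]) (use \<alpha> in \<open>auto simp: indicator_def\<close>)
  also have "\<dots> = (\<integral>z. 2 * \<alpha> * (indicator {1..} z * z powr (-(2*\<alpha>)-1))
                     - 2 * \<alpha> * (indicator {r..} z * z powr (-(2*\<alpha>)-1)) \<partial>lborel)"
    using r by (intro Bochner_Integration.integral_cong) (auto simp: pareto_half_def indicator_def)
  also have "\<dots> = 1 - r powr (-2*\<alpha>)"
    using has_bochner_integral_powr_tail[of "2*\<alpha>" 1] has_bochner_integral_powr_tail[of "2*\<alpha>" r] \<alpha> r
    by (simp add: has_bochner_integral_iff)
  finally show ?thesis .
qed

text \<open>On \<open>[1,r)\<close> the factor \<open>1 - (z/r) powr \<alpha>\<close> splits the
  integral into tails of exponents \<open>2*\<alpha>\<close> and \<open>\<alpha>\<close>. With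
  \<open>c = r powr (-\<alpha>)\<close> they add up to \<open>(1 - c*c) - (2*c - 2*c*c)\<close>, a
  perfect square; this is what later makes \<open>Psi\<close> multiplicative.\<close>

lemma integral_sym_pareto_Psi:
  assumes \<alpha>: "0 < \<alpha>" and r: "1 \<le> r"
  shows "(\<integral>z. Psi \<alpha> (z / r) \<partial>sym_pareto \<alpha>) = (1 - r powr (-\<alpha>))\<^sup>2"
proof -
  have "(\<integral>z. Psi \<alpha> (z / r) \<partial>sym_pareto \<alpha>)
     = (\<integral>z. pareto_half \<alpha> z * (Psi \<alpha> (z / r) + Psi \<alpha> (- z / r)) \<partial>lborel)"
    by (rule integral_sym_pareto[where B=1]) (use \<alpha> in \<open>auto simp: Psi_def\<close>)
  also have "\<dots> = (\<integral>z. (2 * \<alpha> * (indicator {1..} z * z powr (-(2*\<alpha>)-1))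
                     - 2 * \<alpha> * (indicator {r..} z * z powr (-(2*\<alpha>)-1)))
                  - (2 * \<alpha> * r powr (-\<alpha>) * (indicator {1..} z * z powr (-\<alpha>-1))
                     - 2 * \<alpha> * r powr (-\<alpha>) * (indicator {r..} z * z powr (-\<alpha>-1))) \<partial>lborel)"
  proof (intro Bochner_Integration.integral_cong refl)
    fix z
    consider "z < 1" | "1 \<le> z" "z < r" | "r \<le> z" by linarith
    then show "pareto_half \<alpha> z * (Psi \<alpha> (z / r) + Psi \<alpha> (- z / r)) =
      (2 * \<alpha> * (indicator {1..} z * z powr (-(2*\<alpha>)-1))
                     - 2 * \<alpha> * (indicator {r..} z * z powr (-(2*\<alpha>)-1)))
                  - (2 * \<alpha> * r powr (-\<alpha>) * (indicator {1..} z * z powr (-\<alpha>-1))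
                     - 2 * \<alpha> * r powr (-\<alpha>) * (indicator {r..} z * z powr (-\<alpha>-1)))"
    proof cases
      case 2
      then have le: "(z / r) powr \<alpha> \<le> 1" using \<alpha> r by (intro powr_le1) auto
      have "(z / r) powr \<alpha> = z powr \<alpha> * r powr (-\<alpha>)"
        using 2 r by (simp add: powr_divide powr_minus_divide)
      moreover have "z powr (-(2*\<alpha>)-1) * z powr \<alpha> = z powr (-\<alpha>-1)"
        by (simp flip: powr_add)
      ultimately have "z powr (-(2*\<alpha>)-1) * (z / r) powr \<alpha> = r powr (-\<alpha>) * z powr (-\<alpha>-1)"
        by (metis mult.assoc mult.commute)
      with 2 le r show ?thesis
        by (simp add: pareto_half_def Psi_def algebra_simps)
    next
      case 3
      then have "(z / r) powr \<alpha> \<ge> 1" using \<alpha> r by (intro ge_one_powr_ge_zero) auto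
      with 3 r show ?thesis by (simp add: Psi_def)
    qed (use r in \<open>auto simp: pareto_half_def\<close>)
  qed
  also have "\<dots> = (1 - r powr (-2*\<alpha>)) - (2 * r powr (-\<alpha>) - 2 * r powr (-\<alpha>) * r powr (-\<alpha>))"
    using has_bochner_integral_powr_tail[of "2*\<alpha>" 1] has_bochner_integral_powr_tail[of "2*\<alpha>" r]
     has_bochner_integral_powr_tail[of "\<alpha>" 1] has_bochner_integral_powr_tail[of "\<alpha>" r] \<alpha> r
    by (simp add: has_bochner_integral_iff)
  also have "\<dots> = (1 - r powr (-\<alpha>))\<^sup>2"
    by (simp add: power2_eq_square algebra_simps flip: powr_add)
  finally show ?thesis .
qed

lemma integral_sym_pareto_eq_0:
  fixes f :: "real \<Rightarrow> real"
  assumes \<alpha>: "0 < \<alpha>" and "f \<in> borel_measurable borel" and "\<And>z. \<bar>f z\<bar> \<le> B"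
    and f0: "\<And>z. 1 \<le> \<bar>z\<bar> \<Longrightarrow> f z = 0"
  shows "(\<integral>z. f z \<partial>sym_pareto \<alpha>) = 0"
proof -
  have "pareto_half \<alpha> z * (f z + f (-z)) = 0" for z
    using f0[of z] f0[of "-z"] by (auto simp: pareto_half_def indicator_def)
  then show ?thesis by (simp only: integral_sym_pareto[OF assms(1-3)] Bochner_Integration.integral_zero)
qed

section \<open>The transition kernel\<close>

text \<open>
  Realises a step from \<open>x\<close> as a function of \<open>y\<close> drawn from \<open>\<nu>\<close>, a symmetric Pareto \<open>z\<close> and a uniform \<open>u\<close>; the
  sign of the symmetric two-point part is that of \<open>z\<close>. For \<open>x = y = 0\<close> the value is \<open>0\<close> because \<open>M = 0\<close>.
\<close>
definition kendall_map :: "real \<Rightarrow> real \<Rightarrow> real \<times> real \<times> real \<Rightarrow> real" where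
  "kendall_map \<alpha> x = (\<lambda>(y, z, u).
     max \<bar>x\<bar> \<bar>y\<bar> * (if u < (min \<bar>x\<bar> \<bar>y\<bar> / max \<bar>x\<bar> \<bar>y\<bar>) powr \<alpha> then z else sgn z))"

lemma kendall_map_measurable [measurable]:
  "(\<lambda>(x, q). kendall_map \<alpha> x q) \<in> borel_measurable (borel \<Otimes>\<^sub>M (borel \<Otimes>\<^sub>M (borel \<Otimes>\<^sub>M borel)))"
  unfolding kendall_map_def by measurable

lemma kendall_map_section_measurable [measurable]:
  "kendall_map \<alpha> x \<in> borel_measurable (borel \<Otimes>\<^sub>M (borel \<Otimes>\<^sub>M borel))"
  unfolding kendall_map_def by measurable

abbreviation unif :: "real measure" where
  "unif \<equiv> uniform_measure lborel {0..1}"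

lemma prob_space_unif: "prob_space unif"
  by (intro prob_space_uniform_measure) auto

lemma integral_unif_less:
  fixes p c d :: real
  assumes "0 \<le> p" "p \<le> 1"
  shows "(\<integral>u. (if u < p then c else d) \<partial>unif) = p * c + (1 - p) * d"
proof -
  interpret prob_space unif by (rule prob_space_unif)
  have "{0..1} \<inter> {..<p} = {0..<p}" using assms by auto
  then have m: "measure unif {..<p} = p"
    using assms by (subst measure_uniform_measure) auto
  have "(\<integral>u. (if u < p then c else d) \<partial>unif) = (\<integral>u. d + (c - d) * indicator {..<p} u \<partial>unif)"
    by (intro Bochner_Integration.integral_cong) (auto simp: indicator_def)
  also have "\<dots> = d + (c - d) * p"
    using prob_space m by (simp add: emeasure_eq_measure)
  finally show ?thesis by (simp add: algebra_simps)
qed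

lemma min_div_max_powr_bounds:
  fixes x y \<alpha> :: real
  assumes "0 < \<alpha>"
  shows "0 \<le> (min \<bar>x\<bar> \<bar>y\<bar> / max \<bar>x\<bar> \<bar>y\<bar>) powr \<alpha>" "(min \<bar>x\<bar> \<bar>y\<bar> / max \<bar>x\<bar> \<bar>y\<bar>) powr \<alpha> \<le> 1"
proof -
  have "min \<bar>x\<bar> \<bar>y\<bar> / max \<bar>x\<bar> \<bar>y\<bar> \<le> 1"
    by (cases "max \<bar>x\<bar> \<bar>y\<bar> = 0") (auto simp: divide_le_eq_1 max_def min_def)
  then show "(min \<bar>x\<bar> \<bar>y\<bar> / max \<bar>x\<bar> \<bar>y\<bar>) powr \<alpha> \<le> 1"
    using assms by (intro powr_le1) auto
qed auto

locale kendall_walk =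
  fixes \<alpha> :: real and \<nu> :: "real measure"
  assumes \<alpha>: "0 < \<alpha>" and sym: "sym_prob \<nu>"
begin

lemma sets_\<nu> [simp, measurable_cong]: "sets \<nu> = sets borel"
  using sym by (simp add: sym_prob_def)

lemma space_\<nu> [simp]: "space \<nu> = UNIV"
  using sets_eq_imp_space_eq[OF sets_\<nu>] by simp

sublocale \<nu>: prob_space \<nu>
  using sym by (simp add: sym_prob_def)

sublocale \<pi>: prob_space "sym_pareto \<alpha>"
  by (rule prob_space_sym_pareto[OF \<alpha>])

sublocale U: prob_space unif
  by (rule prob_space_unif)

sublocale \<pi>U: pair_prob_space "sym_pareto \<alpha>" unif ..

sublocale Q: pair_prob_space \<nu> "sym_pareto \<alpha> \<Otimes>\<^sub>M unif" ..

abbreviation noise :: "(real \<times> real \<times> real) measure" where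
  "noise \<equiv> \<nu> \<Otimes>\<^sub>M (sym_pareto \<alpha> \<Otimes>\<^sub>M unif)"

lemma kendall_map_noise [measurable]: "kendall_map \<alpha> x \<in> borel_measurable noise"
  using kendall_map_section_measurable by (simp cong: measurable_cong_sets)

text \<open>The integral of \<open>f\<close> with respect to the Kendall convolution of the symmetrised point masses at \<open>x\<close> and \<open>y\<close>.\<close>
definition kendall_mean :: "(real \<Rightarrow> real) \<Rightarrow> real \<Rightarrow> real \<Rightarrow> real" where
  "kendall_mean f x y = (let M = max \<bar>x\<bar> \<bar>y\<bar>; p = (min \<bar>x\<bar> \<bar>y\<bar> / M) powr \<alpha> in
     p * (\<integral>z. f (M * z) \<partial>sym_pareto \<alpha>) + (1 - p) * ((f M + f (-M)) / 2))"

text \<open>Fubini, with \<open>u\<close> integrated first: \<open>u\<close> selects the Pareto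
  branch with probability \<open>p\<close>, and the other branch averages over the sign of
  \<open>z\<close>.\<close>

lemma integral_kendall_map:
  fixes f :: "real \<Rightarrow> real"
  assumes [measurable]: "f \<in> borel_measurable borel" and B: "\<And>z. \<bar>f z\<bar> \<le> B"
  shows "(\<integral>q. f (kendall_map \<alpha> x q) \<partial>noise) = (\<integral>y. kendall_mean f x y \<partial>\<nu>)"
proof -
  have I: "integrable noise (\<lambda>q. f (kendall_map \<alpha> x q))"
    by (rule Q.P.integrable_const_bound[where B=B]) (use B in auto)
  have "(\<integral>q. f (kendall_map \<alpha> x q) \<partial>noise)
      = (\<integral>y. \<integral>w. f (kendall_map \<alpha> x (y, w)) \<partial>(sym_pareto \<alpha> \<Otimes>\<^sub>M unif) \<partial>\<nu>)"
    by (rule Q.integral_fst'[symmetric, OF I])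
  also have "\<dots> = (\<integral>y. kendall_mean f x y \<partial>\<nu>)"
  proof (intro Bochner_Integration.integral_cong refl)
    fix y
    define M where "M = max \<bar>x\<bar> \<bar>y\<bar>"
    define p where "p = (min \<bar>x\<bar> \<bar>y\<bar> / M) powr \<alpha>"
    have p: "0 \<le> p" "p \<le> 1" using min_div_max_powr_bounds[OF \<alpha>] by (auto simp: p_def M_def)
    have I2: "integrable (sym_pareto \<alpha> \<Otimes>\<^sub>M unif) (\<lambda>w. f (kendall_map \<alpha> x (y, w)))"
      by (rule \<pi>U.P.integrable_const_bound[where B=B]) (use B in auto)
    have I3: "integrable (sym_pareto \<alpha>) (\<lambda>z. f (M * z))" "integrable (sym_pareto \<alpha>) (\<lambda>z. f (M * sgn z))"
      by (rule \<pi>.integrable_const_bound[where B=B]; use B in auto)+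
    have "(\<integral>w. f (kendall_map \<alpha> x (y, w)) \<partial>(sym_pareto \<alpha> \<Otimes>\<^sub>M unif))
        = (\<integral>z. \<integral>u. f (kendall_map \<alpha> x (y, z, u)) \<partial>unif \<partial>sym_pareto \<alpha>)"
      by (rule \<pi>U.integral_fst'[symmetric, OF I2])
    also have "\<dots> = (\<integral>z. \<integral>u. (if u < p then f (M * z) else f (M * sgn z)) \<partial>unif \<partial>sym_pareto \<alpha>)"
      by (intro Bochner_Integration.integral_cong refl) (simp add: kendall_map_def p_def M_def)
    also have "\<dots> = (\<integral>z. p * f (M * z) + (1 - p) * f (M * sgn z) \<partial>sym_pareto \<alpha>)"
      by (simp add: integral_unif_less[OF p])
    also have "\<dots> = p * (\<integral>z. f (M * z) \<partial>sym_pareto \<alpha>) + (1 - p) * ((f M + f (-M)) / 2)"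
      using I3 integral_sym_pareto_sgn[OF \<alpha> assms(1) B] by simp
    finally show "(\<integral>w. f (kendall_map \<alpha> x (y, w)) \<partial>(sym_pareto \<alpha> \<Otimes>\<^sub>M unif)) = kendall_mean f x y"
      by (simp add: kendall_mean_def Let_def p_def M_def)
  qed
  finally show ?thesis .
qed

lemma kendall_mean_indicator:
  assumes [measurable]: "A \<in> sets borel"
  shows "kendall_mean (indicator A) x y = kendall_pair \<alpha> x y A"
proof (cases "max \<bar>x\<bar> \<bar>y\<bar> = 0")
  case True
  \<comment> \<open>Here \<open>0 / 0 = 0\<close> and \<open>0 powr \<alpha> = 0\<close>, so the
    Pareto weight vanishes and the point mass at 0 remains, as in the clause \<open>M = 0\<close> of
    \<open>kendall_pair\<close>.\<close>
  then have "x = 0" "y = 0" by (auto simp: max_def split: if_splits)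
  then show ?thesis by (simp add: kendall_mean_def kendall_pair_def)
next
  case False
  define M where "M = max \<bar>x\<bar> \<bar>y\<bar>"
  have "{z. M * z \<in> A} = (\<lambda>z. M * z) -` A \<inter> space borel" by auto
  also have "\<dots> \<in> sets borel" by measurable
  finally have [measurable]: "{z. M * z \<in> A} \<in> sets borel" .
  have "(\<integral>z. (indicator A (M * z) :: real) \<partial>sym_pareto \<alpha>)
      = (\<integral>z. indicator {z. M * z \<in> A} z \<partial>sym_pareto \<alpha>)"
    by (intro Bochner_Integration.integral_cong) (auto simp: indicator_def)
  then have "(\<integral>z. indicator A (M * z) \<partial>sym_pareto \<alpha>) = measure (sym_pareto \<alpha>) {z. M * z \<in> A}"
    by simp
  moreover have "indicator {z. M * z \<in> A} (1::real) = (indicator A M :: real)"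
    "indicator {z. M * z \<in> A} (-1::real) = (indicator A (-M) :: real)"
    by (auto simp: indicator_def)
  ultimately show ?thesis
    using False by (simp add: kendall_mean_def kendall_pair_def sdelta_def Let_def flip: M_def)
qed

lemma kendall_mean_measurable [measurable]:
  assumes [measurable]: "f \<in> borel_measurable borel"
  shows "kendall_mean f x \<in> borel_measurable borel"
  unfolding kendall_mean_def Let_def by measurable

text \<open>\<open>measure_of\<close> returns the given set function only if it is countably
  additive, and the null measure otherwise. Agreement on Borel sets with the law of
  \<open>kendall_map\<close> settles this and gives a concrete representation of the kernel.\<close>

lemma kendall_step_eq: "kendall_step \<alpha> \<nu> x = distr noise borel (kendall_map \<alpha> x)" (is "_ = ?K")
proof -
  interpret K: prob_space ?K by (rule Q.P.prob_space_distr) simp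
  have "(\<integral>\<^sup>+y. ennreal (kendall_pair \<alpha> x y A) \<partial>\<nu>) = emeasure ?K A" if [measurable]: "A \<in> sets borel" for A
  proof -
    have nonneg: "0 \<le> kendall_mean (indicator A) x y" for y
      using min_div_max_powr_bounds[OF \<alpha>, of x y] by (auto simp: kendall_mean_def Let_def)
    have le: "kendall_mean (indicator A) x y \<le> 1" for y
    proof -
      have 1: "(\<integral>z. indicator A (max \<bar>x\<bar> \<bar>y\<bar> * z) \<partial>sym_pareto \<alpha>) \<le> (1::real)"
        by (rule \<pi>.integral_le_const) (auto intro!: \<pi>.integrable_const_bound[where B=1] simp: indicator_def)
      have 2: "(indicator A z + indicator A (- z)) / 2 \<le> (1::real)" for z
        by (simp add: indicator_def)
      have "p * c + (1 - p) * d \<le> 1" if "0 \<le> p" "p \<le> 1" "c \<le> 1" "d \<le> 1" for p c d :: real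
        using convex_bound_le[of c 1 d p "1 - p"] that by simp
      from this[OF min_div_max_powr_bounds[OF \<alpha>] 1 2] show ?thesis
        unfolding kendall_mean_def Let_def .
    qed
    have "measure ?K A = (\<integral>q. indicator A (kendall_map \<alpha> x q) \<partial>noise)"
      using integral_distr[of "kendall_map \<alpha> x" noise borel "indicator A :: real \<Rightarrow> real"] by simp
    also have "\<dots> = (\<integral>y. kendall_mean (indicator A) x y \<partial>\<nu>)"
      by (rule integral_kendall_map[where B=1]) (auto simp: indicator_def)
    finally have "measure ?K A = (\<integral>y. kendall_mean (indicator A) x y \<partial>\<nu>)" .
    moreover have "(\<integral>\<^sup>+y. ennreal (kendall_mean (indicator A) x y) \<partial>\<nu>) = ennreal (\<integral>y. kendall_mean (indicator A) x y \<partial>\<nu>)"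
      using nonneg le by (intro nn_integral_eq_integral \<nu>.integrable_const_bound[where B=1]) auto
    ultimately show ?thesis by (simp add: kendall_mean_indicator K.emeasure_eq_measure)
  qed
  then have "kendall_step \<alpha> \<nu> x = measure_of UNIV (sets borel) (emeasure ?K)"
    unfolding kendall_step_def
    by (intro measure_of_eq) (auto simp: sets.sigma_sets_eq[of borel, simplified])
  also have "\<dots> = ?K" using measure_of_of_measure[of ?K] by simp
  finally show ?thesis .
qed

lemma sets_kendall_step [simp, measurable_cong]: "sets (kendall_step \<alpha> \<nu> x) = sets borel"
  and space_kendall_step [simp]: "space (kendall_step \<alpha> \<nu> x) = UNIV"
  by (simp_all add: kendall_step_eq)

lemma prob_space_kendall_step: "prob_space (kendall_step \<alpha> \<nu> x)"
  unfolding kendall_step_eq by (rule Q.P.prob_space_distr) simp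

lemma integral_kendall_step:
  fixes f :: "real \<Rightarrow> real"
  assumes [measurable]: "f \<in> borel_measurable borel" and B: "\<And>z. \<bar>f z\<bar> \<le> B"
  shows "(\<integral>y. f y \<partial>kendall_step \<alpha> \<nu> x) = (\<integral>y. kendall_mean f x y \<partial>\<nu>)"
  unfolding kendall_step_eq by (simp add: integral_distr integral_kendall_map[OF assms])

text \<open>Measurability in the starting point is hidden in \<open>kendall_step\<close>. Written as
  the image of a fixed noise under a jointly measurable map, one step becomes a parameter integral,
  and the induction goes through.\<close>

lemma II_aux_measurable [measurable]: "II_aux \<alpha> \<nu> a t k \<in> borel_measurable borel"
proof (induction k)
  case 0
  then show ?case by simp
next
  case (Suc k)
  note [measurable] = Suc.IH
  have "(\<lambda>(x, q). II_aux \<alpha> \<nu> a t k (kendall_map \<alpha> x q)) \<in> borel_measurable (borel \<Otimes>\<^sub>M noise)"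
    using measurable_compose[OF kendall_map_measurable Suc.IH]
    by (simp add: split_beta' cong: measurable_cong_sets)
  then have [measurable]: "(\<lambda>x. \<integral>q. II_aux \<alpha> \<nu> a t k (kendall_map \<alpha> x q) \<partial>noise) \<in> borel_measurable borel"
    by (rule Q.P.borel_measurable_lebesgue_integral)
  have "II_aux \<alpha> \<nu> a t (Suc k)
      = (\<lambda>x. if x \<le> a then \<integral>q. II_aux \<alpha> \<nu> a t k (kendall_map \<alpha> x q) \<partial>noise else 0)"
    by (auto simp: fun_eq_iff kendall_step_eq integral_distr)
  then show ?case by simp
qed

end

section \<open>One-sided constraints under symmetric laws\<close>

lemma integral_one_sided:
  fixes h :: "real \<Rightarrow> real"
  assumes "prob_space M" and [measurable_cong]: "sets M = sets borel"
    and inv: "distr M borel uminus = M"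
    and [measurable]: "h \<in> borel_measurable borel" and B: "\<And>y. \<bar>h y\<bar> \<le> B"
    and even: "\<And>y. h (-y) = h y" and a: "0 < a"
  shows "(\<integral>y. (if y \<le> a then h y else 0) \<partial>M)
       = ((\<integral>y. h y \<partial>M) + (\<integral>y. (if \<bar>y\<bar> \<le> a then h y else 0) \<partial>M)) / 2"
proof -
  interpret prob_space M by fact
  have B0: "0 \<le> B" using B[of 0] by linarith
  have I: "integrable M f" if "f \<in> borel_measurable borel" "\<And>y. \<bar>f y\<bar> \<le> B" for f :: "real \<Rightarrow> real"
    by (rule integrable_const_bound[where B=B]) (use that in auto)
  let ?f = "\<lambda>y. if y \<le> a then h y else 0"
  have I1: "integrable M ?f" "integrable M (\<lambda>y. ?f (-y))" "integrable M h"
    "integrable M (\<lambda>y. if \<bar>y\<bar> \<le> a then h y else 0)"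
    by (rule I; use B B0 in auto)+
  have "(\<integral>y. ?f y \<partial>M) = (\<integral>y. ?f y \<partial>distr M borel uminus)" by (simp add: inv)
  also have "\<dots> = (\<integral>y. ?f (-y) \<partial>M)" by (subst integral_distr) auto
  finally have "2 * (\<integral>y. ?f y \<partial>M) = (\<integral>y. ?f y + ?f (-y) \<partial>M)"
    using I1 by (subst Bochner_Integration.integral_add) auto
  \<comment> \<open>As \<open>a > 0\<close>, at least one of \<open>y\<close> and \<open>-y\<close>
    is at most \<open>a\<close>, and both are exactly when
    \<open>\<bar>y\<bar> \<le> a\<close>.\<close>
  also have "\<dots> = (\<integral>y. h y + (if \<bar>y\<bar> \<le> a then h y else 0) \<partial>M)"
    using a by (intro Bochner_Integration.integral_cong) (auto simp: even)
  also have "\<dots> = (\<integral>y. h y \<partial>M) + (\<integral>y. (if \<bar>y\<bar> \<le> a then h y else 0) \<partial>M)"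
    using I1 by (subst Bochner_Integration.integral_add) auto
  finally show ?thesis by simp
qed

definition profile :: "real \<Rightarrow> real \<Rightarrow> real \<Rightarrow> real \<times> real \<times> real \<times> real \<Rightarrow> real \<Rightarrow> real" where
  "profile \<alpha> a t = (\<lambda>(A, B, C, E) y. A * indicator {y. \<bar>y\<bar> < t} y + B * Psi \<alpha> (y / t)
     + C * indicator {y. \<bar>y\<bar> < a} y + E * Psi \<alpha> (y / a))"

text \<open>The half of the profile restricted to \<open>[-a,a]\<close> is re-expanded in the two
  functions at level \<open>a\<close>, which stay unchanged there. The points with
  \<open>\<bar>y\<bar> = a\<close> must be null: for \<open>a < t\<close> the restricted indicator
  of \<open>\<bar>y\<bar> < t\<close> is 1 there, while that of \<open>\<bar>y\<bar> < a\<close> is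
  0.\<close>

lemma integral_one_sided_profile:
  assumes "prob_space M" and [measurable_cong]: "sets M = sets borel"
    and inv: "distr M borel uminus = M" and AE: "AE y in M. \<bar>y\<bar> \<noteq> a"
    and \<alpha>: "0 < \<alpha>" and a: "0 < a" "a \<le> t"
  shows "(\<integral>y. (if y \<le> a then profile \<alpha> a t (A, B, C, E) y else 0) \<partial>M)
    = A / 2 * (\<integral>y. indicator {y. \<bar>y\<bar> < t} y \<partial>M) + B / 2 * (\<integral>y. Psi \<alpha> (y / t) \<partial>M)
      + (A / 2 + B * Psi \<alpha> (a / t) / 2 + C) * (\<integral>y. indicator {y. \<bar>y\<bar> < a} y \<partial>M)
      + (B * (1 - Psi \<alpha> (a / t)) / 2 + E) * (\<integral>y. Psi \<alpha> (y / a) \<partial>M)"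
proof -
  interpret prob_space M by fact
  define P where "P = Psi \<alpha> (a / t)"
  let ?h = "profile \<alpha> a t (A, B, C, E)"
  have ind: "indicator {y. \<bar>y\<bar> < s} y = (if \<bar>y\<bar> < s then 1 else (0::real))" for s y :: real
    by (simp add: indicator_def)
  have m [measurable]: "?h \<in> borel_measurable borel"
    by (simp add: profile_def)
  have I: "integrable M (\<lambda>y. Psi \<alpha> (y / s))" "integrable M (indicator {y. \<bar>y\<bar> < s} :: real \<Rightarrow> real)" for s
    by (rule integrable_const_bound[where B=1]; auto simp: abs_Psi_le_1 indicator_def)+
  have 1: "(\<integral>y. (if y \<le> a then ?h y else 0) \<partial>M)
       = ((\<integral>y. ?h y \<partial>M) + (\<integral>y. (if \<bar>y\<bar> \<le> a then ?h y else 0) \<partial>M)) / 2"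
  proof (rule integral_one_sided[OF assms(1-3) m, where B="\<bar>A\<bar> + \<bar>B\<bar> + \<bar>C\<bar> + \<bar>E\<bar>"])
    fix y :: real
    have i: "\<bar>indicator {y. \<bar>y\<bar> < s} y\<bar> \<le> (1::real)" for s by (simp add: indicator_def)
    have b: "\<bar>X * Y\<bar> \<le> \<bar>X\<bar>" if "\<bar>Y\<bar> \<le> 1" for X Y :: real
      using mult_left_mono[OF that, of "\<bar>X\<bar>"] by (simp add: abs_mult)
    show "\<bar>?h y\<bar> \<le> \<bar>A\<bar> + \<bar>B\<bar> + \<bar>C\<bar> + \<bar>E\<bar>"
      unfolding profile_def prod.case
      by (intro order_trans[OF abs_triangle_ineq add_mono] b i abs_Psi_le_1)
    show "?h (-y) = ?h y" by (simp add: profile_def Psi_def ind)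
  qed (use a in auto)
  have 2: "(\<integral>y. (if \<bar>y\<bar> \<le> a then ?h y else 0) \<partial>M)
    = (\<integral>y. (A + B * P + C) * indicator {y. \<bar>y\<bar> < a} y + (B * (1 - P) + E) * Psi \<alpha> (y / a) \<partial>M)"
  proof (rule integral_cong_AE)
    show "AE y in M. (if \<bar>y\<bar> \<le> a then ?h y else 0)
        = (A + B * P + C) * indicator {y. \<bar>y\<bar> < a} y + (B * (1 - P) + E) * Psi \<alpha> (y / a)"
      using AE
    proof eventually_elim
      case (elim y)
      show ?case
      proof (cases "\<bar>y\<bar> < a")
        case True
        have le: "(a / t) powr \<alpha> \<le> 1" "(\<bar>y\<bar> / a) powr \<alpha> \<le> 1" "(\<bar>y\<bar> / t) powr \<alpha> \<le> 1"
          using True a \<alpha> by (intro powr_le1; simp)+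
        \<comment> \<open>Multiplicativity of powers means
          \<open>1 - Psi \<alpha> (y/t) = (1 - P) * (1 - Psi \<alpha> (y/a))\<close>, which is the
          convex combination below.\<close>
        have prod: "(a / t) powr \<alpha> * (\<bar>y\<bar> / a) powr \<alpha> = (\<bar>y\<bar> / t) powr \<alpha>"
          using a by (simp add: powr_divide)
        have Ps: "P = 1 - (a / t) powr \<alpha>" "Psi \<alpha> (y / a) = 1 - (\<bar>y\<bar> / a) powr \<alpha>"
          "Psi \<alpha> (y / t) = 1 - (\<bar>y\<bar> / t) powr \<alpha>"
          using le a by (simp_all add: P_def Psi_def)
        have psi: "Psi \<alpha> (y / t) = P + (1 - P) * Psi \<alpha> (y / a)"
          unfolding Ps prod[symmetric] by (simp add: algebra_simps)
        show ?thesis using True a unfolding profile_def prod.case psi by (simp add: algebra_simps)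
      next
        case False
        with elim have *: "a < \<bar>y\<bar>" by simp
        then have "1 \<le> (\<bar>y\<bar> / a) powr \<alpha>" using a \<alpha> by (intro ge_one_powr_ge_zero) auto
        with * a show ?thesis by (simp add: Psi_def)
      qed
    qed
  qed auto
  have 3: "(\<integral>y. (A + B * P + C) * indicator {y. \<bar>y\<bar> < a} y + (B * (1 - P) + E) * Psi \<alpha> (y / a) \<partial>M)
    = (A + B * P + C) * (\<integral>y. indicator {y. \<bar>y\<bar> < a} y \<partial>M) + (B * (1 - P) + E) * (\<integral>y. Psi \<alpha> (y / a) \<partial>M)"
    using I by (simp del: Bochner_Integration.integral_indicator)
  have 4: "(\<integral>y. ?h y \<partial>M) = A * (\<integral>y. indicator {y. \<bar>y\<bar> < t} y \<partial>M) + B * (\<integral>y. Psi \<alpha> (y / t) \<partial>M)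
      + C * (\<integral>y. indicator {y. \<bar>y\<bar> < a} y \<partial>M) + E * (\<integral>y. Psi \<alpha> (y / a) \<partial>M)"
    using I by (simp add: profile_def del: Bochner_Integration.integral_indicator)
  show ?thesis
    unfolding 1 2 3 4 P_def[symmetric] by (simp add: field_simps)
qed

section \<open>Symmetry of the kernel, its null points, and its action on indicators and
  \<open>Psi\<close>\<close>

context kendall_walk begin

lemma distr_uminus_\<nu>: "distr \<nu> borel uminus = \<nu>"
proof (rule measure_eqI)
  fix A :: "real set" assume "A \<in> sets (distr \<nu> borel uminus)"
  then have A [measurable]: "A \<in> sets borel" by simp
  have "uminus -` A = uminus ` A" by force
  moreover have "measure \<nu> (uminus ` A) = measure \<nu> A" using sym A by (simp add: sym_prob_def)
  ultimately show "emeasure (distr \<nu> borel uminus) A = emeasure \<nu> A"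
    by (simp add: emeasure_distr \<nu>.emeasure_eq_measure)
qed simp

lemma kendall_mean_uminus:
  assumes [measurable]: "f \<in> borel_measurable borel" and B: "\<And>z. \<bar>f z\<bar> \<le> B"
  shows "kendall_mean (\<lambda>y. f (-y)) x y = kendall_mean f x y"
  using integral_sym_pareto_uminus[OF \<alpha>, of "\<lambda>z. f (max \<bar>x\<bar> \<bar>y\<bar> * z)" B] B
  by (simp add: kendall_mean_def Let_def add.commute)

text \<open>The kernel mixes symmetric laws, so every step is symmetric whatever its starting point.
  This lets \<open>integral_one_sided\<close> apply at each stage of the iteration.\<close>

lemma distr_uminus_kendall_step: "distr (kendall_step \<alpha> \<nu> x) borel uminus = kendall_step \<alpha> \<nu> x"
proof (rule measure_eqI)
  interpret K: prob_space "kendall_step \<alpha> \<nu> x" by (rule prob_space_kendall_step)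
  fix A :: "real set" assume "A \<in> sets (distr (kendall_step \<alpha> \<nu> x) borel uminus)"
  then have A [measurable]: "A \<in> sets borel" by simp
  have "measure (distr (kendall_step \<alpha> \<nu> x) borel uminus) A
      = (\<integral>y. indicator A y \<partial>distr (kendall_step \<alpha> \<nu> x) borel uminus)" by simp
  also have "\<dots> = (\<integral>y. indicator A (-y) \<partial>kendall_step \<alpha> \<nu> x)"
    by (subst integral_distr) auto
  also have "\<dots> = (\<integral>y. kendall_mean (\<lambda>y. indicator A (-y)) x y \<partial>\<nu>)"
    by (rule integral_kendall_step[where B=1]) (auto simp: indicator_def)
  also have "\<dots> = (\<integral>y. kendall_mean (indicator A) x y \<partial>\<nu>)"
    by (intro Bochner_Integration.integral_cong refl kendall_mean_uminus[where B=1]) (auto simp: indicator_def)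
  also have "\<dots> = (\<integral>y. indicator A y \<partial>kendall_step \<alpha> \<nu> x)"
    by (rule integral_kendall_step[where B=1, symmetric]) (auto simp: indicator_def)
  also have "\<dots> = measure (kendall_step \<alpha> \<nu> x) A" by simp
  finally show "emeasure (distr (kendall_step \<alpha> \<nu> x) borel uminus) A = emeasure (kendall_step \<alpha> \<nu> x) A"
    using prob_space.finite_measure[OF K.prob_space_distr[of uminus borel]]
    by (simp add: K.emeasure_eq_measure finite_measure.emeasure_eq_measure)
qed simp

text \<open>Put \<open>X = (M/s) powr \<alpha>\<close> and \<open>p = (m/M) powr \<alpha>\<close>.
  If \<open>0 < M < s\<close>, the Pareto part contributes \<open>p * (1 - X*X)\<close> and the
  two-point part \<open>1 - p\<close>; the sum is \<open>1 - p*X*X\<close>, where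
  \<open>p*X = (m/s) powr \<alpha>\<close>. If \<open>s \<le> M\<close>, all outcomes have modulus
  at least \<open>s\<close>.\<close>

lemma kendall_mean_indicator_less:
  assumes s: "0 < s"
  shows "kendall_mean (indicator {z. \<bar>z\<bar> < s}) x y
    = (if \<bar>x\<bar> < s \<and> \<bar>y\<bar> < s then 1 - (\<bar>x\<bar> / s) powr \<alpha> * (\<bar>y\<bar> / s) powr \<alpha> else 0)"
proof -
  define M where "M = max \<bar>x\<bar> \<bar>y\<bar>"
  define m where "m = min \<bar>x\<bar> \<bar>y\<bar>"
  have mM: "0 \<le> m" "m \<le> M" by (auto simp: m_def M_def)
  have prod: "(\<bar>x\<bar> / s) powr \<alpha> * (\<bar>y\<bar> / s) powr \<alpha> = (m / s) powr \<alpha> * (M / s) powr \<alpha>"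
    by (auto simp: m_def M_def min_def max_def)
  have less: "\<bar>x\<bar> < s \<and> \<bar>y\<bar> < s \<longleftrightarrow> M < s" by (auto simp: M_def)
  have kendall_mean: "kendall_mean (indicator {z. \<bar>z\<bar> < s}) x y
     = (m / M) powr \<alpha> * (\<integral>z. indicator {z. \<bar>z\<bar> < s} (M * z) \<partial>sym_pareto \<alpha>)
       + (1 - (m / M) powr \<alpha>) * indicator {z. \<bar>z\<bar> < s} M"
    by (simp add: kendall_mean_def Let_def m_def M_def indicator_def)
  consider "M = 0" | "s \<le> M" | "0 < M" "M < s" using mM by linarith
  then show ?thesis
  proof cases
    case 1
    then show ?thesis unfolding kendall_mean prod less using s by simp
  next
    case 2
    have "(\<integral>z. indicator {z. \<bar>z\<bar> < s} (M * z) \<partial>sym_pareto \<alpha>) = (0::real)"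
    proof (rule integral_sym_pareto_eq_0[OF \<alpha>, where B=1])
      fix z :: real assume "1 \<le> \<bar>z\<bar>"
      then have "s \<le> M * \<bar>z\<bar>" using 2 s mult_mono[of s M 1 "\<bar>z\<bar>"] by simp
      then show "indicator {z. \<bar>z\<bar> < s} (M * z) = (0::real)"
        using mM by (simp add: abs_mult)
    qed (auto simp: indicator_def)
    then show ?thesis unfolding kendall_mean prod less using 2 s by simp
  next
    case 3
    have "(\<integral>z. indicator {z. \<bar>z\<bar> < s} (M * z) \<partial>sym_pareto \<alpha>)
        = (\<integral>z. indicator {z. \<bar>z\<bar> < s / M} z \<partial>sym_pareto \<alpha>)"
      using 3 by (intro Bochner_Integration.integral_cong)
        (auto simp: indicator_def abs_mult field_simps)
    also have "\<dots> = 1 - (s / M) powr (-2*\<alpha>)"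
      using 3 by (intro integral_sym_pareto_less[OF \<alpha>]) simp
    also have "(s / M) powr (-2*\<alpha>) = (M / s) powr \<alpha> * (M / s) powr \<alpha>"
      using 3 s by (simp add: powr_minus_divide powr_divide mult_2_right flip: powr_add)
    finally have eq: "(\<integral>z. indicator {z. \<bar>z\<bar> < s} (M * z) \<partial>sym_pareto \<alpha>)
        = 1 - (M / s) powr \<alpha> * (M / s) powr \<alpha>" .
    have pe: "(m / M) powr \<alpha> * (M / s) powr \<alpha> = (m / s) powr \<alpha>"
      using 3 mM s by (simp add: powr_divide)
    show ?thesis unfolding kendall_mean prod less eq pe[symmetric] using 3 by (simp add: algebra_simps)
  qed
qed

lemma Psi_less: "0 < s \<Longrightarrow> \<bar>x\<bar> < s \<Longrightarrow> Psi \<alpha> (x / s) = 1 - (\<bar>x\<bar> / s) powr \<alpha>"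
  using \<alpha> powr_le1[of \<alpha> "\<bar>x\<bar> / s"] by (simp add: Psi_def)

lemma Psi_ge: "0 < s \<Longrightarrow> s \<le> \<bar>x\<bar> \<Longrightarrow> Psi \<alpha> (x / s) = 0"
  using \<alpha> ge_one_powr_ge_zero[of "\<bar>x\<bar> / s" \<alpha>] by (simp add: Psi_def)

lemma Psi_abs: "Psi \<alpha> (\<bar>x\<bar> / s) = Psi \<alpha> (x / s)"
  by (simp add: Psi_def)

text \<open>\<open>Psi\<close> is a generalised character of the Kendall convolution. For
  \<open>0 < M < s\<close>, with \<open>X = (M/s) powr \<alpha>\<close> and
  \<open>p = (m/M) powr \<alpha>\<close>, the mean \<open>p * (1-X)^2 + (1-p) * (1-X)\<close>
  factors as \<open>(1-X) * (1-p*X)\<close>.\<close>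

lemma kendall_mean_Psi:
  assumes s: "0 < s"
  shows "kendall_mean (\<lambda>z. Psi \<alpha> (z / s)) x y = Psi \<alpha> (x / s) * Psi \<alpha> (y / s)"
proof -
  define M where "M = max \<bar>x\<bar> \<bar>y\<bar>"
  define m where "m = min \<bar>x\<bar> \<bar>y\<bar>"
  have mM: "0 \<le> m" "m \<le> M" by (auto simp: m_def M_def)
  have "Psi \<alpha> (\<bar>x\<bar> / s) * Psi \<alpha> (\<bar>y\<bar> / s) = Psi \<alpha> (m / s) * Psi \<alpha> (M / s)"
    by (auto simp: m_def M_def min_def max_def)
  then have prod: "Psi \<alpha> (x / s) * Psi \<alpha> (y / s) = Psi \<alpha> (m / s) * Psi \<alpha> (M / s)"
    by (simp add: Psi_abs)
  have "Psi \<alpha> (- M / s) = Psi \<alpha> (M / s)" by (simp add: Psi_def)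
  then have kendall_mean: "kendall_mean (\<lambda>z. Psi \<alpha> (z / s)) x y
     = (m / M) powr \<alpha> * (\<integral>z. Psi \<alpha> (M * z / s) \<partial>sym_pareto \<alpha>)
       + (1 - (m / M) powr \<alpha>) * Psi \<alpha> (M / s)"
    unfolding kendall_mean_def Let_def m_def[symmetric] M_def[symmetric] by simp
  consider "M = 0" | "s \<le> M" | "0 < M" "M < s" using mM by linarith
  then show ?thesis
  proof cases
    case 1
    then show ?thesis unfolding kendall_mean prod using mM by (simp add: Psi_def)
  next
    case 2
    have "(\<integral>z. Psi \<alpha> (M * z / s) \<partial>sym_pareto \<alpha>) = (0::real)"
    proof (rule integral_sym_pareto_eq_0[OF \<alpha>, where B=1])
      fix z :: real assume "1 \<le> \<bar>z\<bar>"
      then have "s \<le> M * \<bar>z\<bar>" using 2 s mult_mono[of s M 1 "\<bar>z\<bar>"] by simp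
      then show "Psi \<alpha> (M * z / s) = 0"
        using mM s by (intro Psi_ge) (simp_all add: abs_mult)
    qed (auto simp: abs_Psi_le_1)
    moreover have "Psi \<alpha> (M / s) = 0" using 2 s by (intro Psi_ge) auto
    ultimately show ?thesis unfolding kendall_mean prod by simp
  next
    case 3
    have "(\<integral>z. Psi \<alpha> (M * z / s) \<partial>sym_pareto \<alpha>) = (\<integral>z. Psi \<alpha> (z / (s / M)) \<partial>sym_pareto \<alpha>)"
      by (simp add: mult.commute)
    also have "\<dots> = (1 - (s / M) powr (-\<alpha>))\<^sup>2"
      using 3 by (intro integral_sym_pareto_Psi[OF \<alpha>]) simp
    also have "(s / M) powr (-\<alpha>) = (M / s) powr \<alpha>"
      using 3 s by (simp add: powr_minus_divide powr_divide)
    finally have eq: "(\<integral>z. Psi \<alpha> (M * z / s) \<partial>sym_pareto \<alpha>) = (1 - (M / s) powr \<alpha>)\<^sup>2" .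
    have pe: "(m / s) powr \<alpha> = (m / M) powr \<alpha> * (M / s) powr \<alpha>"
      using 3 mM s by (simp add: powr_divide)
    have Psi: "Psi \<alpha> (m / s) = 1 - (m / s) powr \<alpha>" "Psi \<alpha> (M / s) = 1 - (M / s) powr \<alpha>"
      using Psi_less[of s m] Psi_less[of s M] 3 mM s by auto
    show ?thesis unfolding kendall_mean prod eq Psi pe by (simp add: power2_eq_square algebra_simps)
  qed
qed

lemma AE_\<nu>_abs_neq:
  assumes "measure \<nu> {c} = 0"
  shows "AE y in \<nu>. \<bar>y\<bar> \<noteq> c"
proof -
  have "measure \<nu> (uminus ` {c}) = measure \<nu> {c}" 
    using sym[unfolded sym_prob_def, THEN conjunct2, THEN conjunct2, THEN bspec, of "{c}"] by simp
  then have "measure \<nu> {-c} = 0" using assms by simp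
  then have "AE y in \<nu>. y \<notin> {-c}" by (subst (asm) \<nu>.prob_eq_0) simp_all
  moreover have "AE y in \<nu>. y \<notin> {c}" using assms by (subst (asm) \<nu>.prob_eq_0) simp_all
  ultimately show ?thesis by eventually_elim auto
qed

text \<open>The two-point part charges modulus \<open>c\<close> only if
  \<open>max \<bar>x\<bar> \<bar>y\<bar> = c\<close>, which is excluded for \<open>x\<close> by
  assumption and for almost every \<open>y\<close>. The Pareto part has a density, so after scaling
  by \<open>M\<close> it does not charge the two points either.\<close>

lemma AE_kendall_step_abs_neq:
  assumes "measure \<nu> {c} = 0" "0 < c" "\<bar>x\<bar> \<noteq> c"
  shows "AE y in kendall_step \<alpha> \<nu> x. \<bar>y\<bar> \<noteq> c"
proof -
  interpret K: prob_space "kendall_step \<alpha> \<nu> x" by (rule prob_space_kendall_step)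
  have z: "kendall_mean (indicator {z. \<bar>z\<bar> = c}) x y = 0" if "\<bar>y\<bar> \<noteq> c" for y
  proof -
    define M where "M = max \<bar>x\<bar> \<bar>y\<bar>"
    have M: "M \<noteq> c" "0 \<le> M" using that assms by (auto simp: M_def max_def)
    have "(\<integral>z. indicator {z. \<bar>z\<bar> = c} (M * z) \<partial>sym_pareto \<alpha>)
      = (\<integral>z. pareto_half \<alpha> z * (indicator {z. \<bar>z\<bar> = c} (M * z) + indicator {z. \<bar>z\<bar> = c} (M * - z)) \<partial>lborel)"
      by (rule integral_sym_pareto[OF \<alpha>, where B=1]) (auto simp: indicator_def)
    also have "\<dots> = (\<integral>z. 0 \<partial>(lborel :: real measure))"
    proof (rule integral_cong_AE)
      have "AE z in lborel. z \<noteq> c / M" "AE z in lborel. z \<noteq> - c / M" by (rule AE_lborel_singleton)+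
      then show "AE z in lborel. pareto_half \<alpha> z * (indicator {z. \<bar>z\<bar> = c} (M * z)
          + indicator {z. \<bar>z\<bar> = c} (M * - z)) = 0"
      proof eventually_elim
        case (elim z)
        \<comment> \<open>If \<open>M = 0\<close>, this is \<open>0 \<noteq> c\<close>; otherwise
          the two excluded points are the only solutions of the equation.\<close>
        then have "\<bar>M * z\<bar> \<noteq> c"
          using assms(2) by (cases "M = 0") (auto simp: abs_if field_simps split: if_splits)
        then show ?case by simp
      qed
    qed auto
    finally have "(\<integral>z. indicator {z. \<bar>z\<bar> = c} (M * z) \<partial>sym_pareto \<alpha>) = (0::real)" by simp
    then show ?thesis using M by (simp add: kendall_mean_def Let_def flip: M_def)
  qed
  have "measure (kendall_step \<alpha> \<nu> x) {z. \<bar>z\<bar> = c} = (\<integral>y. indicator {z. \<bar>z\<bar> = c} y \<partial>kendall_step \<alpha> \<nu> x)"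
    by simp
  also have "\<dots> = (\<integral>y. kendall_mean (indicator {z. \<bar>z\<bar> = c}) x y \<partial>\<nu>)"
    by (rule integral_kendall_step[where B=1]) (auto simp: indicator_def)
  also have "\<dots> = (\<integral>y. 0 \<partial>\<nu>)"
    using AE_\<nu>_abs_neq[OF assms(1)] by (intro integral_cong_AE) (auto simp: z)
  finally have "measure (kendall_step \<alpha> \<nu> x) {z. \<bar>z\<bar> = c} = 0" by simp
  then have "AE y in kendall_step \<alpha> \<nu> x. y \<notin> {z. \<bar>z\<bar> = c}"
    by (subst (asm) K.prob_eq_0) auto
  then show ?thesis by simp
qed

text \<open>\<open>Hf\<close> integrates over a closed interval, the kernel formula over an open
  one. They agree because \<open>s\<close> and, by symmetry, \<open>-s\<close> carry no
  mass.\<close>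

lemma integral_\<nu>_powr:
  assumes s: "0 < s" and "measure \<nu> {s} = 0"
  shows "integrable \<nu> (\<lambda>y. indicator {y. \<bar>y\<bar> < s} y * (\<bar>y\<bar> / s) powr \<alpha>)"
    and "(\<integral>y. indicator {y. \<bar>y\<bar> < s} y * (\<bar>y\<bar> / s) powr \<alpha> \<partial>\<nu>) = Hf \<alpha> \<nu> s"
proof -
  show "integrable \<nu> (\<lambda>y. indicator {y. \<bar>y\<bar> < s} y * (\<bar>y\<bar> / s) powr \<alpha>)"
  proof (rule \<nu>.integrable_const_bound[where B=1])
    show "AE y in \<nu>. norm (indicator {y. \<bar>y\<bar> < s} y * (\<bar>y\<bar> / s) powr \<alpha>) \<le> 1"
      using s \<alpha> by (intro AE_I2) (auto simp: indicator_def intro!: powr_le1)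
  qed simp
  have "(\<integral>y. indicator {y. \<bar>y\<bar> < s} y * (\<bar>y\<bar> / s) powr \<alpha> \<partial>\<nu>)
      = (\<integral>y. s powr (-\<alpha>) * (indicator {-s..s} y * \<bar>y\<bar> powr \<alpha>) \<partial>\<nu>)"
  proof (rule integral_cong_AE)
    show "AE y in \<nu>. indicator {y. \<bar>y\<bar> < s} y * (\<bar>y\<bar> / s) powr \<alpha>
        = s powr (-\<alpha>) * (indicator {-s..s} y * \<bar>y\<bar> powr \<alpha>)"
      using AE_\<nu>_abs_neq[OF assms(2)]
    proof eventually_elim
      case (elim y)
      then have "y \<in> {-s..s} \<longleftrightarrow> \<bar>y\<bar> < s" by auto
      then show ?case using s by (simp add: indicator_def powr_divide powr_minus_divide)
    qed
  qed auto
  then show "(\<integral>y. indicator {y. \<bar>y\<bar> < s} y * (\<bar>y\<bar> / s) powr \<alpha> \<partial>\<nu>) = Hf \<alpha> \<nu> s"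
    by (simp add: Hf_def)
qed

text \<open>On \<open>\<bar>y\<bar> < s\<close> the constant 1 is \<open>Psi \<alpha> (y/s)\<close>
  plus \<open>(\<bar>y\<bar>/s) powr \<alpha>\<close>. By symmetry the left side is
  \<open>2*F(s) - 1\<close>, so this is the relation between \<open>F\<close>, \<open>G\<close> and
  \<open>H\<close>.\<close>

lemma integral_\<nu>_less:
  assumes s: "0 < s" and "measure \<nu> {s} = 0"
  shows "(\<integral>y. indicator {y. \<bar>y\<bar> < s} y \<partial>\<nu>) = Gf \<alpha> \<nu> s + Hf \<alpha> \<nu> s"
proof -
  have I: "integrable \<nu> (\<lambda>y. Psi \<alpha> (y / s))"
    by (rule \<nu>.integrable_const_bound[where B=1]) (auto simp: abs_Psi_le_1)
  have "(\<integral>y. indicator {y. \<bar>y\<bar> < s} y \<partial>\<nu>)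
      = (\<integral>y. Psi \<alpha> (y / s) + indicator {y. \<bar>y\<bar> < s} y * (\<bar>y\<bar> / s) powr \<alpha> \<partial>\<nu>)"
    using s Psi_less[OF s] Psi_ge[OF s]
    by (intro Bochner_Integration.integral_cong) (auto simp: indicator_def)
  also have "\<dots> = Gf \<alpha> \<nu> s + Hf \<alpha> \<nu> s"
    using I integral_\<nu>_powr[OF assms] by (simp add: Gf_def)
  finally show ?thesis .
qed

lemma integral_kendall_step_less:
  assumes s: "0 < s" and "measure \<nu> {s} = 0"
  shows "(\<integral>y. indicator {y. \<bar>y\<bar> < s} y \<partial>kendall_step \<alpha> \<nu> x)
    = indicator {y. \<bar>y\<bar> < s} x * Gf \<alpha> \<nu> s + Psi \<alpha> (x / s) * Hf \<alpha> \<nu> s"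
proof -
  have I: "integrable \<nu> (indicator {y. \<bar>y\<bar> < s} :: real \<Rightarrow> real)"
    by (rule \<nu>.integrable_const_bound[where B=1]) (auto simp: indicator_def)
  have "(\<integral>y. indicator {y. \<bar>y\<bar> < s} y \<partial>kendall_step \<alpha> \<nu> x)
      = (\<integral>y. kendall_mean (indicator {y. \<bar>y\<bar> < s}) x y \<partial>\<nu>)"
    by (rule integral_kendall_step[where B=1]) (auto simp: indicator_def)
  also have "\<dots> = (\<integral>y. indicator {y. \<bar>y\<bar> < s} x * (indicator {y. \<bar>y\<bar> < s} y
       - (\<bar>x\<bar> / s) powr \<alpha> * (indicator {y. \<bar>y\<bar> < s} y * (\<bar>y\<bar> / s) powr \<alpha>)) \<partial>\<nu>)"
    by (intro Bochner_Integration.integral_cong) (auto simp: kendall_mean_indicator_less[OF s] indicator_def)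
  also have "\<dots> = indicator {y. \<bar>y\<bar> < s} x * ((Gf \<alpha> \<nu> s + Hf \<alpha> \<nu> s) - (\<bar>x\<bar> / s) powr \<alpha> * Hf \<alpha> \<nu> s)"
    using I integral_\<nu>_powr[OF assms] integral_\<nu>_less[OF assms]
    by (simp del: Bochner_Integration.integral_indicator)
  \<comment> \<open>Collecting the terms in \<open>Hf\<close>: their factor,
    \<open>1 - (\<bar>x\<bar>/s) powr \<alpha>\<close> on \<open>\<bar>x\<bar> < s\<close>, is
    \<open>Psi \<alpha> (x/s)\<close>.\<close>
  also have "\<dots> = indicator {y. \<bar>y\<bar> < s} x * Gf \<alpha> \<nu> s + Psi \<alpha> (x / s) * Hf \<alpha> \<nu> s"
    using Psi_less[OF s, of x] Psi_ge[OF s, of x]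
    by (cases "\<bar>x\<bar> < s") (simp_all add: right_diff_distrib mult.commute)
  finally show ?thesis .
qed

lemma integral_kendall_step_Psi:
  assumes s: "0 < s"
  shows "(\<integral>y. Psi \<alpha> (y / s) \<partial>kendall_step \<alpha> \<nu> x) = Psi \<alpha> (x / s) * Gf \<alpha> \<nu> s"
proof -
  have "(\<integral>y. Psi \<alpha> (y / s) \<partial>kendall_step \<alpha> \<nu> x) = (\<integral>y. kendall_mean (\<lambda>z. Psi \<alpha> (z / s)) x y \<partial>\<nu>)"
    by (rule integral_kendall_step[where B=1]) (auto simp: abs_Psi_le_1)
  then show ?thesis by (simp add: kendall_mean_Psi[OF s] Gf_def)
qed

end

section \<open>The backward iteration\<close>

text \<open>Coordinates, in the functions of \<open>profile\<close>, of the iterate before the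
  constraint is imposed. One step imposes it, which halves the level-\<open>t\<close> part and moves
  the other half to level \<open>a\<close>, and then applies the kernel. \<open>A\<close> and
  \<open>B\<close> evolve autonomously and drive \<open>C\<close> and \<open>E\<close>.\<close>

primrec profile_coeffs :: "real \<Rightarrow> real \<Rightarrow> real \<Rightarrow> real \<Rightarrow> real \<Rightarrow> nat \<Rightarrow> real \<times> real \<times> real \<times> real" where
  "profile_coeffs Ga Gt Ha Ht P 0 = (1, 0, 0, 0)"
| "profile_coeffs Ga Gt Ha Ht P (Suc k) = (case profile_coeffs Ga Gt Ha Ht P k of (A, B, C, E) \<Rightarrow>
     (A / 2 * Gt, A / 2 * Ht + B / 2 * Gt, (A / 2 + B * P / 2 + C) * Ga,
      (A / 2 + B * P / 2 + C) * Ha + (B * (1 - P) / 2 + E) * Ga))"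

context kendall_walk begin

context
  fixes a t :: real
  assumes a: "0 < a" "a \<le> t" and null: "measure \<nu> {a} = 0" "measure \<nu> {t} = 0"
begin

abbreviation walk_coeffs :: "nat \<Rightarrow> real \<times> real \<times> real \<times> real" where
  "walk_coeffs \<equiv> profile_coeffs (Gf \<alpha> \<nu> a) (Gf \<alpha> \<nu> t) (Hf \<alpha> \<nu> a) (Hf \<alpha> \<nu> t) (Psi \<alpha> (a / t))"

lemma profile_measurable [measurable]: "profile \<alpha> a t w \<in> borel_measurable borel"
  by (cases w) (simp add: profile_def)

text \<open>Stated for a general symmetric law \<open>M\<close>, since it is needed both for a step
  of the kernel and for the outermost integration against \<open>\<nu>\<close>.\<close>

lemma integral_II_aux:
  assumes "prob_space M" and [measurable_cong]: "sets M = sets borel"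
    and inv: "distr M borel uminus = M"
    and AE: "AE y in M. \<bar>y\<bar> \<noteq> a" "AE y in M. \<bar>y\<bar> \<noteq> t"
    and rep: "\<And>x. \<bar>x\<bar> \<noteq> a \<Longrightarrow> \<bar>x\<bar> \<noteq> t \<Longrightarrow>
      II_aux \<alpha> \<nu> a t k x = (if x \<le> a then profile \<alpha> a t (A, B, C, E) x else 0)"
  shows "(\<integral>y. II_aux \<alpha> \<nu> a t k y \<partial>M)
    = A / 2 * (\<integral>y. indicator {y. \<bar>y\<bar> < t} y \<partial>M) + B / 2 * (\<integral>y. Psi \<alpha> (y / t) \<partial>M)
      + (A / 2 + B * Psi \<alpha> (a / t) / 2 + C) * (\<integral>y. indicator {y. \<bar>y\<bar> < a} y \<partial>M)
      + (B * (1 - Psi \<alpha> (a / t)) / 2 + E) * (\<integral>y. Psi \<alpha> (y / a) \<partial>M)"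
proof -
  have "(\<integral>y. II_aux \<alpha> \<nu> a t k y \<partial>M) = (\<integral>y. (if y \<le> a then profile \<alpha> a t (A, B, C, E) y else 0) \<partial>M)"
  proof (rule integral_cong_AE)
    show "AE y in M. II_aux \<alpha> \<nu> a t k y = (if y \<le> a then profile \<alpha> a t (A, B, C, E) y else 0)"
      using AE by eventually_elim (rule rep)
  qed auto
  then show ?thesis
    by (simp only: integral_one_sided_profile[OF assms(1-3) AE(1) \<alpha> a])
qed

text \<open>
  The points \<open>\<plusminus>a, \<plusminus>t\<close> must be excluded: from them the kernel has atoms at \<open>\<plusminus>a, \<plusminus>t\<close>. They are null for \<open>\<nu>\<close> and
  for the step from any other point.
\<close>
lemma II_aux_eq_profile:
  assumes "\<bar>x\<bar> \<noteq> a" "\<bar>x\<bar> \<noteq> t"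
  shows "II_aux \<alpha> \<nu> a t k x = (if x \<le> a then profile \<alpha> a t (walk_coeffs k) x else 0)"
  using assms
proof (induction k arbitrary: x)
  case 0
  then show ?case by (simp add: profile_def)
next
  case (Suc k)
  obtain A B C E where k: "walk_coeffs k = (A, B, C, E)" by (cases "walk_coeffs k") auto
  show ?case
  proof (cases "x \<le> a")
    case True
    have "0 < t" using a by simp
    have AE: "AE y in kendall_step \<alpha> \<nu> x. \<bar>y\<bar> \<noteq> a" "AE y in kendall_step \<alpha> \<nu> x. \<bar>y\<bar> \<noteq> t"
      using AE_kendall_step_abs_neq Suc.prems null a by auto
    have "II_aux \<alpha> \<nu> a t (Suc k) x = (\<integral>y. II_aux \<alpha> \<nu> a t k y \<partial>kendall_step \<alpha> \<nu> x)"
      using True by simp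
    also have "\<dots> = A / 2 * (\<integral>y. indicator {y. \<bar>y\<bar> < t} y \<partial>kendall_step \<alpha> \<nu> x)
        + B / 2 * (\<integral>y. Psi \<alpha> (y / t) \<partial>kendall_step \<alpha> \<nu> x)
        + (A / 2 + B * Psi \<alpha> (a / t) / 2 + C) * (\<integral>y. indicator {y. \<bar>y\<bar> < a} y \<partial>kendall_step \<alpha> \<nu> x)
        + (B * (1 - Psi \<alpha> (a / t)) / 2 + E) * (\<integral>y. Psi \<alpha> (y / a) \<partial>kendall_step \<alpha> \<nu> x)"
      by (rule integral_II_aux[OF prob_space_kendall_step sets_kendall_step
          distr_uminus_kendall_step AE Suc.IH[unfolded k]])
    also have "\<dots> = A / 2 * (indicator {y. \<bar>y\<bar> < t} x * Gf \<alpha> \<nu> t + Psi \<alpha> (x / t) * Hf \<alpha> \<nu> t)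
        + B / 2 * (Psi \<alpha> (x / t) * Gf \<alpha> \<nu> t)
        + (A / 2 + B * Psi \<alpha> (a / t) / 2 + C)
            * (indicator {y. \<bar>y\<bar> < a} x * Gf \<alpha> \<nu> a + Psi \<alpha> (x / a) * Hf \<alpha> \<nu> a)
        + (B * (1 - Psi \<alpha> (a / t)) / 2 + E) * (Psi \<alpha> (x / a) * Gf \<alpha> \<nu> a)"
      by (simp only: integral_kendall_step_less[OF \<open>0 < t\<close> null(2)] integral_kendall_step_less[OF a(1) null(1)]
        integral_kendall_step_Psi[OF \<open>0 < t\<close>] integral_kendall_step_Psi[OF a(1)])
    also have "\<dots> = profile \<alpha> a t (walk_coeffs (Suc k)) x"
      by (simp add: k profile_def) (simp add: algebra_simps)
    finally show ?thesis using True by simp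
  qed simp
qed

text \<open>The outermost integration is against \<open>\<nu>\<close>, where the indicator at level
  \<open>s\<close> integrates to \<open>G(s) + H(s)\<close> and \<open>Psi\<close> to
  \<open>G(s)\<close>. Hence \<open>k\<close> steps of the recursion describe
  \<open>n = k + 1\<close> integrations.\<close>

lemma II_Suc:
  assumes "walk_coeffs k = (A, B, C, E)"
  shows "II \<alpha> \<nu> (Suc k) a t
    = A / 2 * (Gf \<alpha> \<nu> t + Hf \<alpha> \<nu> t) + B / 2 * Gf \<alpha> \<nu> t
      + (A / 2 + B * Psi \<alpha> (a / t) / 2 + C) * (Gf \<alpha> \<nu> a + Hf \<alpha> \<nu> a)
      + (B * (1 - Psi \<alpha> (a / t)) / 2 + E) * Gf \<alpha> \<nu> a"
proof -
  have "0 < t" using a by simp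
  have "II \<alpha> \<nu> (Suc k) a t = (\<integral>y. II_aux \<alpha> \<nu> a t k y \<partial>\<nu>)" by (simp add: II_def)
  also have "\<dots> = A / 2 * (\<integral>y. indicator {y. \<bar>y\<bar> < t} y \<partial>\<nu>)
      + B / 2 * (\<integral>y. Psi \<alpha> (y / t) \<partial>\<nu>)
      + (A / 2 + B * Psi \<alpha> (a / t) / 2 + C) * (\<integral>y. indicator {y. \<bar>y\<bar> < a} y \<partial>\<nu>)
      + (B * (1 - Psi \<alpha> (a / t)) / 2 + E) * (\<integral>y. Psi \<alpha> (y / a) \<partial>\<nu>)"
    by (rule integral_II_aux[OF \<nu>.prob_space_axioms sets_\<nu> distr_uminus_\<nu>
        AE_\<nu>_abs_neq[OF null(1)] AE_\<nu>_abs_neq[OF null(2)] II_aux_eq_profile[where k=k, unfolded assms]])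
  finally show ?thesis
    by (simp only: integral_\<nu>_less[OF \<open>0 < t\<close> null(2)] integral_\<nu>_less[OF a(1) null(1)]
        Gf_def[symmetric])
qed

end

section \<open>Explicit solution of the recursion and its evaluation\<close>

lemma Gf_nonneg_mono:
  assumes "0 < a" "a \<le> t"
  shows "0 \<le> Gf \<alpha> \<nu> a" "Gf \<alpha> \<nu> a \<le> Gf \<alpha> \<nu> t"
proof -
  have I: "integrable \<nu> (\<lambda>y. Psi \<alpha> (y / s))" for s
    by (rule \<nu>.integrable_const_bound[where B=1]) (auto simp: abs_Psi_le_1)
  show "0 \<le> Gf \<alpha> \<nu> a" unfolding Gf_def by (rule integral_nonneg_AE) (simp add: Psi_def)
  show "Gf \<alpha> \<nu> a \<le> Gf \<alpha> \<nu> t"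
    unfolding Gf_def
  proof (rule integral_mono[OF I I])
    fix y
    have "\<bar>y / t\<bar> \<le> \<bar>y / a\<bar>" using assms by (simp add: divide_left_mono)
    then have "\<bar>y / t\<bar> powr \<alpha> \<le> \<bar>y / a\<bar> powr \<alpha>" using \<alpha> by (intro powr_mono2) auto
    then show "Psi \<alpha> (y / a) \<le> Psi \<alpha> (y / t)" by (simp add: Psi_def)
  qed
qed

end

text \<open>
  Here \<open>G(t) = 2q\<close>, \<open>G(a) = q + \<delta>\<close> and \<open>H(t) = 2h\<close>; the constants \<open>r, s, y, z\<close> are those of the particular solution
  of the form \<open>q\<^sup>k\<close> times an affine function of \<open>k\<close>. The last identity carries the factor \<open>q + \<delta>\<close> because
  without it a power \<open>(q + \<delta>)\<^bsup>k-1\<^esup>\<close> would appear, and \<open>G(a)\<close> may be \<open>0\<close>.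
\<close>
lemma profile_coeffs_closed_form:
  fixes q \<delta> h Ha P :: real
  assumes \<delta>: "\<delta> \<noteq> 0" and q: "q \<noteq> 0"
    and wdef: "w = h * P / (2 * q)" and vdef: "v = h * (1 - P) / (2 * q)"
    and rdef: "r = - q * w / \<delta>" and sdef: "s = - q * (1/2 + w - r) / \<delta>"
    and zdef: "z = - (q * v + Ha * r) / \<delta>" and ydef: "y = - (q * v + Ha * s - q * z) / \<delta>"
    and k: "profile_coeffs (q + \<delta>) (2 * q) Ha (2 * h) P k = (A, B, C, E)"
  shows "A = q ^ k" "B = k * h / q * q ^ k"
    "A / 2 + B * P / 2 + C = q ^ k * (s + r * k) + (1/2 - s) * (q + \<delta>) ^ k"
    "(B * (1 - P) / 2 + E) * (q + \<delta>)
       = (q + \<delta>) * q ^ k * (y + z * k) - y * (q + \<delta>) * (q + \<delta>) ^ k + k * Ha * (1/2 - s) * (q + \<delta>) ^ k"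
proof -
  have w: "w * q * 2 = h * P" and v: "v * q * 2 = h * (1 - P)"
    and r: "r * \<delta> = - q * w" and s: "s * \<delta> = - q * (1/2 + w - r)"
    and z: "z * \<delta> = - (q * v + Ha * r)" and y: "y * \<delta> = - (q * v + Ha * s - q * z)"
    using \<delta> q by (simp_all add: wdef vdef rdef sdef zdef ydef)
  have "A = q ^ k \<and> B = k * h / q * q ^ k \<and>
    A / 2 + B * P / 2 + C = q ^ k * (s + r * k) + (1/2 - s) * (q + \<delta>) ^ k \<and>
    (B * (1 - P) / 2 + E) * (q + \<delta>)
       = (q + \<delta>) * q ^ k * (y + z * k) - y * (q + \<delta>) * (q + \<delta>) ^ k + k * Ha * (1/2 - s) * (q + \<delta>) ^ k"
    using k
  proof (induction k arbitrary: A B C E)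
    case 0
    then show ?case by simp
  next
    case (Suc k)
    obtain A' B' C' E' where k: "profile_coeffs (q + \<delta>) (2 * q) Ha (2 * h) P k = (A', B', C', E')"
      by (cases "profile_coeffs (q + \<delta>) (2 * q) Ha (2 * h) P k") auto
    note IH = Suc.IH[OF k]
    define X where "X = (q + \<delta>) ^ k"
    define Y where "Y = q ^ k"
    define n where "n = real k"
    define \<gamma> where "\<gamma> = A' / 2 + B' * P / 2 + C'"
    \<comment> \<open>The new \<open>E\<close> depends on \<open>E'\<close> only through this
      product, so the induction never divides by \<open>q + \<delta> = G(a)\<close>.\<close>
    define V where "V = (B' * (1 - P) / 2 + E') * (q + \<delta>)"
    have A: "A = q * A'" and B: "B = A' * h + B' * q" and C: "C = \<gamma> * (q + \<delta>)" and E: "E = \<gamma> * Ha + V"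
      using Suc.prems k by (auto simp: \<gamma>_def V_def)
    have A': "A' = Y"
      and \<gamma>: "\<gamma> = Y * (s + r * n) + (1/2 - s) * X"
      and V: "V = (q + \<delta>) * Y * (y + z * n) - y * (q + \<delta>) * X + n * Ha * (1/2 - s) * X"
      using IH unfolding \<gamma>_def V_def X_def Y_def n_def by blast+
    have B': "B' * q = n * h * Y" using IH q by (simp add: Y_def n_def)
    have B1: "B = (n + 1) * h * Y" using B A' B' by (simp add: algebra_simps)
    \<comment> \<open>The terms in \<open>X\<close> cancel. The coefficient of \<open>Y\<close> is
      affine in \<open>n\<close>; the equation for \<open>r\<close> kills its slope, the one for
      \<open>s\<close> its constant term.\<close>
    have g1: "A / 2 + B * P / 2 + C = q * Y * (s + r * (n + 1)) + (1/2 - s) * ((q + \<delta>) * X)"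
    proof -
      have "A / 2 + B * P / 2 + C - (q * Y * (s + r * (n + 1)) + (1/2 - s) * ((q + \<delta>) * X))
        = Y * (q / 2 + (n + 1) * (h * P) / 2 + s * \<delta> + n * (r * \<delta>) - q * r)"
        unfolding A A' B1 C \<gamma> by (simp add: field_simps)
      also have "\<dots> = 0" unfolding w[symmetric] s r by (simp add: field_simps)
      finally show ?thesis by simp
    qed
    \<comment> \<open>The same comparison, with \<open>z\<close> for the slope and \<open>y\<close>
      for the constant term. The part \<open>(1/2 - s) * X\<close> of \<open>\<gamma>\<close> is
      resonant with the eigenvalue \<open>q + \<delta>\<close> and accounts for the term linear in
      \<open>n\<close> in front of \<open>X\<close>.\<close>
    have e1: "(B * (1 - P) / 2 + E) * (q + \<delta>) = (q + \<delta>) * (q * Y) * (y + z * (n + 1))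
        - y * (q + \<delta>) * ((q + \<delta>) * X) + (n + 1) * Ha * (1/2 - s) * ((q + \<delta>) * X)"
    proof -
      have "(B * (1 - P) / 2 + E) - (q * Y * (y + z * (n + 1))
          - y * ((q + \<delta>) * X) + (n + 1) * Ha * (1/2 - s) * X)
        = Y * ((n + 1) * (h * (1 - P)) / 2 + Ha * (s + r * n) + y * \<delta> + n * (z * \<delta>) - q * z)"
        unfolding B1 E \<gamma> V by (simp add: field_simps)
      also have "\<dots> = 0" unfolding v[symmetric] y z by (simp add: field_simps)
      finally have "B * (1 - P) / 2 + E = q * Y * (y + z * (n + 1))
          - y * ((q + \<delta>) * X) + (n + 1) * Ha * (1/2 - s) * X" by simp
      then show ?thesis by (simp only:) (simp add: algebra_simps)
    qed
    have "A = q ^ Suc k" "B = real (Suc k) * h / q * q ^ Suc k"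
      using A A' B1 q by (simp_all add: Y_def n_def field_simps)
    then show ?case using g1 e1 by (simp add: X_def Y_def n_def add.commute)
  qed
  then show "A = q ^ k" "B = k * h / q * q ^ k"
    "A / 2 + B * P / 2 + C = q ^ k * (s + r * k) + (1/2 - s) * (q + \<delta>) ^ k"
    "(B * (1 - P) / 2 + E) * (q + \<delta>)
       = (q + \<delta>) * q ^ k * (y + z * k) - y * (q + \<delta>) * (q + \<delta>) ^ k + k * Ha * (1/2 - s) * (q + \<delta>) ^ k"
    by blast+
qed

text \<open>In the independent parameters \<open>q\<close> and \<open>\<delta>\<close> the only
  denominators are powers of \<open>q\<close> and \<open>\<delta>\<close>. The claim then splits
  into two rational identities, one for the coefficient of \<open>q ^ k\<close> and one for that of
  \<open>(q + \<delta>) ^ k\<close>.\<close>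

lemma profile_coeffs_evaluation:
  fixes Ga Gt Ha Ht P :: real
  assumes D0: "D \<noteq> 0" and Gt: "Gt \<noteq> 0" and D: "D = 2 * Ga - Gt"
    and k: "profile_coeffs Ga Gt Ha Ht P k = (A, B, C, E)"
    and I1: "I1 = Gt / 2 + Ha * P / 2 + Ga / 2"
    and C1: "C1 = I1 - Ga / D * (Ga + Ha * P * (1 - Gt / D))"
    and C2: "C2 = Ha * P / D"
    and C3: "C3 = (Ha * P + Ga) / D - 2 * Ha * Ga * P / D^2"
  shows "A / 2 * (Gt + Ht) + B / 2 * Gt + (A / 2 + B * P / 2 + C) * (Ga + Ha)
      + (B * (1 - P) / 2 + E) * Ga
    = Ga ^ Suc k * ((real (k + 2) * Ha + Ga) / D - 2 * Ga * Ha / D^2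
                    + Ht / D * (real (k + 1) * C2 + C3 - 2 * C2 * Ga / D))
        + (Gt / 2) ^ k * ((Ha + Ht + Ga + Gt) / 2 - Ga * (Ha + Ga) / D + Ga * Gt * Ha / D^2
                    + real k * C1 * Ht / Gt - Ga * Ht / D * (C3 - C2 * Gt / D))"
proof -
  define q where "q = Gt / 2"
  define h where "h = Ht / 2"
  define \<delta> where "\<delta> = D / 2"
  have [simp]: "\<delta> \<noteq> 0" "q \<noteq> 0" using D0 Gt by (auto simp: \<delta>_def q_def)
  have sub: "Ga = q + \<delta>" "Gt = 2 * q" "Ht = 2 * h" "D = 2 * \<delta>"
    by (auto simp: q_def h_def \<delta>_def D field_simps)
  define w where "w = h * P / (2 * q)"
  define v where "v = h * (1 - P) / (2 * q)"
  define r where "r = - q * w / \<delta>"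
  define s where "s = - q * (1/2 + w - r) / \<delta>"
  define z where "z = - (q * v + Ha * r) / \<delta>"
  define y where "y = - (q * v + Ha * s - q * z) / \<delta>"
  note cf = profile_coeffs_closed_form[OF \<open>\<delta> \<noteq> 0\<close> \<open>q \<noteq> 0\<close> w_def v_def r_def s_def z_def y_def k[unfolded sub]]
  define n where "n = real k"
  define Y where "Y = q ^ k"
  define X where "X = (q + \<delta>) ^ k"
  \<comment> \<open>\<open>cf(3,4)\<close> is used before \<open>cf(1,2)\<close>, since replacing
    \<open>A\<close> and \<open>B\<close> first would destroy the combinations that it
    rewrites.\<close>
  have lhs: "A / 2 * (Gt + Ht) + B / 2 * Gt + (A / 2 + B * P / 2 + C) * (Ga + Ha) + (B * (1 - P) / 2 + E) * Ga
    = Y * (q + h + n * h + (s + r * n) * (q + \<delta> + Ha) + (q + \<delta>) * (y + z * n))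
    + X * ((1/2 - s) * (q + \<delta> + Ha) - y * (q + \<delta>) + n * Ha * (1/2 - s))"
    unfolding sub cf(3,4) unfolding cf(1,2) X_def Y_def n_def
    by (simp add: field_simps)
  have rhs: "real (k + 2) = n + 2" "real (k + 1) = n + 1" "real k = n"
    "Ga ^ Suc k = (q + \<delta>) * X" "(Gt / 2) ^ k = Y"
    by (auto simp: n_def X_def Y_def sub)
  have cY: "q + h + n * h + (s + r * n) * (q + \<delta> + Ha) + (q + \<delta>) * (y + z * n)
    = (Ha + Ht + Ga + Gt) / 2 - Ga * (Ha + Ga) / D + Ga * Gt * Ha / D^2
                    + n * C1 * Ht / Gt - Ga * Ht / D * (C3 - C2 * Gt / D)"
    unfolding C1 C2 C3 I1 sub y_def z_def s_def r_def v_def w_def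
    by (simp add: field_simps power2_eq_square power3_eq_cube)
  have cX: "(1/2 - s) * (q + \<delta> + Ha) - y * (q + \<delta>) + n * Ha * (1/2 - s)
    = (q + \<delta>) * (((n + 2) * Ha + Ga) / D - 2 * Ga * Ha / D^2
                    + Ht / D * ((n + 1) * C2 + C3 - 2 * C2 * Ga / D))"
    unfolding C1 C2 C3 I1 sub y_def z_def s_def r_def v_def w_def
    by (simp add: field_simps power2_eq_square power3_eq_cube)
  show ?thesis
    unfolding lhs rhs cX cY by (simp only: ac_simps)
qed

theorem mainTheorem8:
  fixes \<alpha> a t :: real and \<nu> :: "real measure"
  assumes "\<alpha> > 0"
    and "sym_prob \<nu>"
    and "measure \<nu> {0} = 0"
    and "0 < a" and "a \<le> t"
    and "measure \<nu> {a} = 0" and "measure \<nu> {t} = 0"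
    and "Gf \<alpha> \<nu> t \<noteq> 2 * Gf \<alpha> \<nu> a"
  shows "II \<alpha> \<nu> 1 a t = (Hf \<alpha> \<nu> a + Hf \<alpha> \<nu> t + Gf \<alpha> \<nu> a + Gf \<alpha> \<nu> t) / 2
    \<and> (\<forall>n::nat. n \<ge> 2 \<longrightarrow>
      (let Ga = Gf \<alpha> \<nu> a; Gt = Gf \<alpha> \<nu> t; Ha = Hf \<alpha> \<nu> a; Ht = Hf \<alpha> \<nu> t;
           D = 2 * Ga - Gt; P = Psi \<alpha> (a / t);
           I1 = Gt / 2 + Ha * P / 2 + Ga / 2;
           C1 = I1 - Ga / D * (Ga + Ha * P * (1 - Gt / D));
           C2 = Ha * P / D;
           C3 = (Ha * P + Ga) / D - 2 * Ha * Ga * P / D^2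
       in II \<alpha> \<nu> n a t =
          Ga ^ n * ((real (n + 1) * Ha + Ga) / D - 2 * Ga * Ha / D^2
                    + Ht / D * (real n * C2 + C3 - 2 * C2 * Ga / D))
        + (Gt / 2) ^ (n - 1) * (II \<alpha> \<nu> 1 a t - Ga * (Ha + Ga) / D + Ga * Gt * Ha / D^2
                    + real (n - 1) * C1 * Ht / Gt - Ga * Ht / D * (C3 - C2 * Gt / D))))"
proof (intro conjI allI impI)
  interpret kendall_walk \<alpha> \<nu> using assms by unfold_locales
  note II_Suc = II_Suc[OF assms(4-7)]
  show II1: "II \<alpha> \<nu> 1 a t = (Hf \<alpha> \<nu> a + Hf \<alpha> \<nu> t + Gf \<alpha> \<nu> a + Gf \<alpha> \<nu> t) / 2"
    using II_Suc[of 0] by (simp add: field_simps)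
  \<comment> \<open>From \<open>0 \<le> G(a) \<le> G(t)\<close>, vanishing of \<open>G(t)\<close>
    would force \<open>G(t) = 2*G(a) = 0\<close>. So the division by \<open>G(t)\<close> in the
    formula is legitimate.\<close>
  have D: "2 * Gf \<alpha> \<nu> a - Gf \<alpha> \<nu> t \<noteq> 0" and Gt: "Gf \<alpha> \<nu> t \<noteq> 0"
    using assms(8) Gf_nonneg_mono[OF assms(4,5)] by auto
  fix n :: nat assume "n \<ge> 2"
  then obtain k where n: "n = Suc k" by (cases n) auto
  obtain A B C E where k: "profile_coeffs (Gf \<alpha> \<nu> a) (Gf \<alpha> \<nu> t) (Hf \<alpha> \<nu> a) (Hf \<alpha> \<nu> t) (Psi \<alpha> (a / t)) k = (A, B, C, E)"
    by (cases "profile_coeffs (Gf \<alpha> \<nu> a) (Gf \<alpha> \<nu> t) (Hf \<alpha> \<nu> a) (Hf \<alpha> \<nu> t) (Psi \<alpha> (a / t)) k") auto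
  have nn: "Suc k + 1 = k + 2" "real (Suc k) = real (k + 1)" "Suc k - 1 = k" by simp_all
  show "let Ga = Gf \<alpha> \<nu> a; Gt = Gf \<alpha> \<nu> t; Ha = Hf \<alpha> \<nu> a; Ht = Hf \<alpha> \<nu> t;
           D = 2 * Ga - Gt; P = Psi \<alpha> (a / t);
           I1 = Gt / 2 + Ha * P / 2 + Ga / 2;
           C1 = I1 - Ga / D * (Ga + Ha * P * (1 - Gt / D));
           C2 = Ha * P / D;
           C3 = (Ha * P + Ga) / D - 2 * Ha * Ga * P / D^2
       in II \<alpha> \<nu> n a t =
          Ga ^ n * ((real (n + 1) * Ha + Ga) / D - 2 * Ga * Ha / D^2
                    + Ht / D * (real n * C2 + C3 - 2 * C2 * Ga / D))
        + (Gt / 2) ^ (n - 1) * (II \<alpha> \<nu> 1 a t - Ga * (Ha + Ga) / D + Ga * Gt * Ha / D^2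
                    + real (n - 1) * C1 * Ht / Gt - Ga * Ht / D * (C3 - C2 * Gt / D))"
    unfolding Let_def II1 unfolding n nn
    by (rule trans[OF II_Suc[OF k] profile_coeffs_evaluation[OF D Gt refl k refl refl refl refl]])
qed

end
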